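(* Let $\Bbbk$ be a field and let $A$ and $B$ be two connected graded Poisson algebras over $\Bbbk$, each finitely generated in degree one. Suppose that either $\mathcal Z_P(A)$ or $\mathcal Z_P(B)$ is generated in degree at least $2$. If, for some $n\ge 1$, $A[t_1,\dots,t_n]\cong B[s_1,\dots,s_n]$ as ungraded Poisson algebras, then $A\cong B$ as connected graded Poisson algebras.
   Context: A Poisson algebra over a field $\Bbbk$ is a commutative $\Bbbk$-algebra $A$ with a $\Bbbk$-bilinear bracket $\{\,,\}$ making $A$ a Lie algebra and such that $\{a,-\}$ is a $\Bbbk$-derivation of $A$ for every $a\in A$. It is connected graded if $A=\bigoplus_{i\ge0}A_i$ with $A_0=\Bbbk$, $A_iA_j\subseteq A_{i+j}$ and $\{A_i,A_j\}\subseteq A_{i+j}$; it is finitely generated in degree one if it is generated as an algebra by $A_1$ and $\dim_\Bbbk A_1<\infty$. The Poisson center is $\mathcal Z_P(A)=\{z\in A:\{z,a\}=0\ \forall a\in A\}$, a graded subalgebra; it is generated in degree at least $2$ if it is generated as a $\Bbbk$-algebra by homogeneous elements of degree $\ge 2$ (equivalently $\mathcal Z_P(A)\cap A_1=0$). $A[t_1,\dots,t_n]$ carries the bracket extending that of $A$ with all $t_i$ Poisson central. Isomorphisms of graded Poisson algebras are degree-preserving Poisson algebra isomorphisms. *)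

theory Defs
  imports Complex_Main "HOL.Vector_Spaces" "HOL.Hull" "HOL-Library.Poly_Mapping"
begin

locale poisson_algebra = vector_space scale
  for scale :: "'k::field \<Rightarrow> 'a::comm_ring_1 \<Rightarrow> 'a" +
  fixes bracket :: "'a \<Rightarrow> 'a \<Rightarrow> 'a"
  assumes scale_mult: "scale c (x * y) = scale c x * y"
    and bracket_linear_left: "Vector_Spaces.linear scale scale (\<lambda>x. bracket x y)"
    and bracket_linear_right: "Vector_Spaces.linear scale scale (\<lambda>y. bracket x y)"
    and bracket_alternating: "bracket x x = 0"
    and jacobi: "bracket x (bracket y z) + bracket y (bracket z x) + bracket z (bracket x y) = 0"
    and leibniz: "bracket x (y * z) = bracket x y * z + y * bracket x z"

definition is_subalgebra :: "('k::field \<Rightarrow> 'a::comm_ring_1 \<Rightarrow> 'a) \<Rightarrow> 'a set \<Rightarrow> bool" where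
  "is_subalgebra scale T \<longleftrightarrow>
     module.subspace scale T \<and> 1 \<in> T \<and> (\<forall>x\<in>T. \<forall>y\<in>T. x * y \<in> T)"

abbreviation generated_algebra :: "('k::field \<Rightarrow> 'a::comm_ring_1 \<Rightarrow> 'a) \<Rightarrow> 'a set \<Rightarrow> 'a set" where
  "generated_algebra scale S \<equiv> is_subalgebra scale hull S"

text \<open>
  The decomposition axiom says that the whole algebra is the internal direct sum of the
  \<open>grading i\<close>: a finitely supported family \<open>f\<close> of homogeneous components exists and is unique.
  As \<open>1 \<noteq> 0\<close> in class \<^class>\<open>comm_ring_1\<close>, the map \<open>c \<mapsto> scale c 1\<close> is injective, so that
  \<open>grading_0\<close> identifies \<open>grading 0\<close> with the ground field.
\<close>

locale connected_graded_poisson_algebra = poisson_algebra scale bracket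
  for scale :: "'k::field \<Rightarrow> 'a::comm_ring_1 \<Rightarrow> 'a" and bracket :: "'a \<Rightarrow> 'a \<Rightarrow> 'a" +
  fixes grading :: "nat \<Rightarrow> 'a set"
  assumes subspace_grading: "subspace (grading i)"
    and grading_decomposition:
      "\<exists>!f :: nat \<Rightarrow>\<^sub>0 'a. (\<forall>i. Poly_Mapping.lookup f i \<in> grading i) \<and>
        x = (\<Sum>i\<in>Poly_Mapping.keys f. Poly_Mapping.lookup f i)"
    and grading_0: "grading 0 = range (\<lambda>c. scale c 1)"
    and grading_mult: "\<lbrakk>x \<in> grading i; y \<in> grading j\<rbrakk> \<Longrightarrow> x * y \<in> grading (i + j)"
    and grading_bracket: "\<lbrakk>x \<in> grading i; y \<in> grading j\<rbrakk> \<Longrightarrow> bracket x y \<in> grading (i + j)"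

definition finitely_generated_in_degree_one ::
  "('k::field \<Rightarrow> 'a::comm_ring_1 \<Rightarrow> 'a) \<Rightarrow> (nat \<Rightarrow> 'a set) \<Rightarrow> bool" where
  "finitely_generated_in_degree_one scale grading \<longleftrightarrow>
     generated_algebra scale (grading 1) = UNIV \<and>
     (\<exists>S. finite S \<and> module.span scale S = grading 1)"

definition poisson_center :: "('a::comm_ring_1 \<Rightarrow> 'a \<Rightarrow> 'a) \<Rightarrow> 'a set" where
  "poisson_center bracket = {z. \<forall>a. bracket z a = 0}"

definition generated_in_degree_at_least ::
  "nat \<Rightarrow> ('k::field \<Rightarrow> 'a::comm_ring_1 \<Rightarrow> 'a) \<Rightarrow> (nat \<Rightarrow> 'a set) \<Rightarrow> 'a set \<Rightarrow> bool" where
  "generated_in_degree_at_least d scale grading Z \<longleftrightarrow>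
     (\<exists>S \<subseteq> (\<Union>i\<in>{d..}. grading i). Z = generated_algebra scale S)"

definition poisson_iso ::
  "('k::field \<Rightarrow> 'a::comm_ring_1 \<Rightarrow> 'a) \<Rightarrow> ('a \<Rightarrow> 'a \<Rightarrow> 'a) \<Rightarrow>
   ('k \<Rightarrow> 'b::comm_ring_1 \<Rightarrow> 'b) \<Rightarrow> ('b \<Rightarrow> 'b \<Rightarrow> 'b) \<Rightarrow> ('a \<Rightarrow> 'b) \<Rightarrow> bool" where
  "poisson_iso scale bracket scale' bracket' f \<longleftrightarrow>
     bij f \<and> Vector_Spaces.linear scale scale' f \<and> f 1 = 1 \<and>
     (\<forall>x y. f (x * y) = f x * f y) \<and>
     (\<forall>x y. f (bracket x y) = bracket' (f x) (f y))"

definition poisson_isomorphic ::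
  "('k::field \<Rightarrow> 'a::comm_ring_1 \<Rightarrow> 'a) \<Rightarrow> ('a \<Rightarrow> 'a \<Rightarrow> 'a) \<Rightarrow>
   ('k \<Rightarrow> 'b::comm_ring_1 \<Rightarrow> 'b) \<Rightarrow> ('b \<Rightarrow> 'b \<Rightarrow> 'b) \<Rightarrow> bool" where
  "poisson_isomorphic scale bracket scale' bracket' \<longleftrightarrow>
     (\<exists>f. poisson_iso scale bracket scale' bracket' f)"

definition graded_poisson_isomorphic ::
  "('k::field \<Rightarrow> 'a::comm_ring_1 \<Rightarrow> 'a) \<Rightarrow> ('a \<Rightarrow> 'a \<Rightarrow> 'a) \<Rightarrow> (nat \<Rightarrow> 'a set) \<Rightarrow>
   ('k \<Rightarrow> 'b::comm_ring_1 \<Rightarrow> 'b) \<Rightarrow> ('b \<Rightarrow> 'b \<Rightarrow> 'b) \<Rightarrow> (nat \<Rightarrow> 'b set) \<Rightarrow> bool" where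
  "graded_poisson_isomorphic scale bracket grading scale' bracket' grading' \<longleftrightarrow>
     (\<exists>f. poisson_iso scale bracket scale' bracket' f \<and> (\<forall>i. f ` grading i = grading' i))"

text \<open>
  \<open>('a, 'n) mpoly\<close> is the polynomial ring over \<open>'a\<close> in the variables
  \<open>single (single i 1) 1\<close>, one for each \<open>i :: 'n\<close>; exponents are finitely supported maps
  \<open>'n \<Rightarrow>\<^sub>0 nat\<close>. For \<open>'n :: finite\<close> the number of variables is \<open>CARD('n) \<ge> 1\<close>.
\<close>

type_synonym ('a, 'n) mpoly = "('n \<Rightarrow>\<^sub>0 nat) \<Rightarrow>\<^sub>0 'a"

definition mpoly_scale ::
  "('k::field \<Rightarrow> 'a::comm_ring_1 \<Rightarrow> 'a) \<Rightarrow> 'k \<Rightarrow> ('a, 'n) mpoly \<Rightarrow> ('a, 'n) mpoly" where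
  "mpoly_scale scale c = Poly_Mapping.map (scale c)"

text \<open>
  If all variables are Poisson central, bilinearity and the Leibniz rule force
  \<open>{a t\<^sup>\<alpha>, b t\<^sup>\<beta>} = {a, b} t\<^sup>\<alpha>\<^sup>+\<^sup>\<beta>\<close>.
\<close>

definition mpoly_bracket ::
  "('a::comm_ring_1 \<Rightarrow> 'a \<Rightarrow> 'a) \<Rightarrow> ('a, 'n) mpoly \<Rightarrow> ('a, 'n) mpoly \<Rightarrow> ('a, 'n) mpoly" where
  "mpoly_bracket bracket p q =
     (\<Sum>\<alpha>\<in>Poly_Mapping.keys p. \<Sum>\<beta>\<in>Poly_Mapping.keys q.
        Poly_Mapping.single (\<alpha> + \<beta>)
          (bracket (Poly_Mapping.lookup p \<alpha>) (Poly_Mapping.lookup q \<beta>)))"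

text \<open>
  This is indeed a Poisson bracket on the polynomial ring, it extends the bracket on constants,
  and the variables are Poisson central.
\<close>

lemma mpoly_single_induct [case_names zero single add]:
  fixes p :: "('a::comm_monoid_add, 'n) mpoly"
  assumes "P 0" "\<And>\<alpha> a. P (Poly_Mapping.single \<alpha> a)" "\<And>p q. P p \<Longrightarrow> P q \<Longrightarrow> P (p + q)"
  shows "P p"
proof -
  have "p = (\<Sum>\<alpha>\<in>Poly_Mapping.keys p. Poly_Mapping.single \<alpha> (Poly_Mapping.lookup p \<alpha>))"
    by (rule poly_mapping_eqI) (simp add: lookup_sum lookup_single when_def in_keys_iff)
  moreover have "finite S \<Longrightarrow> P (\<Sum>\<alpha>\<in>S. Poly_Mapping.single \<alpha> (Poly_Mapping.lookup p \<alpha>))" for S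
    by (induction S rule: finite_induct) (auto intro: assms)
  ultimately show ?thesis by (metis finite_keys)
qed

context poisson_algebra
begin

sublocale bl: Vector_Spaces.linear scale scale "\<lambda>x. bracket x y" for y
  by (rule bracket_linear_left)

sublocale br: Vector_Spaces.linear scale scale "\<lambda>y. bracket x y" for x
  by (rule bracket_linear_right)

lemma bracket_anticomm: "bracket y x = - bracket x y"
proof -
  have "0 = bracket (x + y) (x + y)" by (simp only: bracket_alternating)
  also have "\<dots> = bracket x x + bracket y x + (bracket x y + bracket y y)"
    by (simp only: bl.add br.add)
  also have "\<dots> = bracket y x + bracket x y" by (simp add: bracket_alternating)
  finally show ?thesis by (metis eq_neg_iff_add_eq_0)
qed

lemma mult_scale: "x * scale c y = scale c (x * y)"
  by (metis mult.commute scale_mult)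

lemma lookup_mpoly_scale: "Poly_Mapping.lookup (mpoly_scale scale c p) \<alpha> =
    scale c (Poly_Mapping.lookup p \<alpha>)"
  by (simp add: mpoly_scale_def map.rep_eq when_def)

lemma mpoly_scale_single:
  "mpoly_scale scale c (Poly_Mapping.single \<alpha> a) = Poly_Mapping.single \<alpha> (scale c a)"
  by (rule poly_mapping_eqI) (simp add: lookup_mpoly_scale lookup_single when_def)

lemma mpoly_scale_add:
  "mpoly_scale scale c (p + q) = mpoly_scale scale c p + mpoly_scale scale c q"
  by (rule poly_mapping_eqI) (simp add: lookup_mpoly_scale lookup_add scale_right_distrib)

lemma mpoly_scale_zero: "mpoly_scale scale c 0 = 0"
  by (rule poly_mapping_eqI) (simp add: lookup_mpoly_scale)

lemma vector_space_mpoly: "vector_space (mpoly_scale scale)"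
  by unfold_locales
    (auto intro!: poly_mapping_eqI
       simp: lookup_mpoly_scale lookup_add scale_right_distrib scale_left_distrib)

lemma mpoly_bracket_superset:
  assumes "finite S" "Poly_Mapping.keys p \<subseteq> S" "finite T" "Poly_Mapping.keys q \<subseteq> T"
  shows "mpoly_bracket bracket p q =
    (\<Sum>\<alpha>\<in>S. \<Sum>\<beta>\<in>T. Poly_Mapping.single (\<alpha> + \<beta>)
          (bracket (Poly_Mapping.lookup p \<alpha>) (Poly_Mapping.lookup q \<beta>)))"
proof -
  have "(\<Sum>\<beta>\<in>Poly_Mapping.keys q. Poly_Mapping.single (\<alpha> + \<beta>)
          (bracket (Poly_Mapping.lookup p \<alpha>) (Poly_Mapping.lookup q \<beta>))) =
      (\<Sum>\<beta>\<in>T. Poly_Mapping.single (\<alpha> + \<beta>)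
          (bracket (Poly_Mapping.lookup p \<alpha>) (Poly_Mapping.lookup q \<beta>)))" for \<alpha>
    using assms by (intro sum.mono_neutral_left) (auto simp: in_keys_iff br.zero)
  then show ?thesis
    unfolding mpoly_bracket_def using assms
    by (simp, intro sum.mono_neutral_left) (auto simp: in_keys_iff bl.zero)
qed

lemma mpoly_bracket_add_left:
  "mpoly_bracket bracket (p + p') q = mpoly_bracket bracket p q + mpoly_bracket bracket p' q"
proof -
  let ?S = "Poly_Mapping.keys p \<union> Poly_Mapping.keys p'"
  have "Poly_Mapping.keys (p + p') \<subseteq> ?S" by (rule keys_add)
  then show ?thesis
    by (simp add: mpoly_bracket_superset[of ?S _ "Poly_Mapping.keys q"] lookup_add bl.add single_add
        sum.distrib)
qed

lemma mpoly_bracket_add_right: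
  "mpoly_bracket bracket p (q + q') = mpoly_bracket bracket p q + mpoly_bracket bracket p q'"
proof -
  let ?T = "Poly_Mapping.keys q \<union> Poly_Mapping.keys q'"
  have "Poly_Mapping.keys (q + q') \<subseteq> ?T" by (rule keys_add)
  then show ?thesis
    by (simp add: mpoly_bracket_superset[of "Poly_Mapping.keys p" _ ?T] lookup_add br.add single_add
        sum.distrib)
qed

lemma mpoly_bracket_zero [simp]: "mpoly_bracket bracket 0 q = 0" "mpoly_bracket bracket p 0 = 0"
  by (simp_all add: mpoly_bracket_def)

lemma mpoly_bracket_single:
  "mpoly_bracket bracket (Poly_Mapping.single \<alpha> a) (Poly_Mapping.single \<beta> b) =
     Poly_Mapping.single (\<alpha> + \<beta>) (bracket a b)"
  by (simp add: mpoly_bracket_superset[of "{\<alpha>}" _ "{\<beta>}"] bl.zero br.zero)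

lemma mpoly_bracket_anticomm: "mpoly_bracket bracket q p = - mpoly_bracket bracket p q"
  by (simp add: mpoly_bracket_def sum.swap[of _ "Poly_Mapping.keys q" "Poly_Mapping.keys p"] single_uminus add.commute sum_negf
      bracket_anticomm[of "Poly_Mapping.lookup p _" "Poly_Mapping.lookup q _"])

lemma bracket_one: "bracket x 1 = 0"
  using leibniz[of x 1 1] by simp

lemma mpoly_bracket_const:
  "mpoly_bracket bracket (Poly_Mapping.single 0 a) (Poly_Mapping.single 0 b) =
     Poly_Mapping.single 0 (bracket a b)"
  by (simp add: mpoly_bracket_single)

lemma mpoly_variable_central:
  "Poly_Mapping.single (Poly_Mapping.single i 1) 1 \<in> poisson_center (mpoly_bracket bracket)"
proof -
  have "bracket 1 a = 0" for a by (metis bracket_one bracket_anticomm neg_0_equal_iff_equal)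
  then have "mpoly_bracket bracket (Poly_Mapping.single (Poly_Mapping.single i 1) 1) q = 0" for q
    by (induction q rule: mpoly_single_induct)
      (simp_all add: mpoly_bracket_single mpoly_bracket_add_right)
  then show ?thesis by (simp add: poisson_center_def)
qed

lemma mpoly_bracket_alternating: "mpoly_bracket bracket p p = 0"
proof (induction p rule: mpoly_single_induct)
  case (add p q)
  then show ?case
    by (simp add: mpoly_bracket_add_left mpoly_bracket_add_right mpoly_bracket_anticomm[of q p])
qed (simp_all add: mpoly_bracket_single bracket_alternating)

lemma mpoly_bracket_scale_right:
  "mpoly_bracket bracket p (mpoly_scale scale c q) = mpoly_scale scale c (mpoly_bracket bracket p q)"
proof (induction q rule: mpoly_single_induct)
  case (single \<beta> b)
  show ?case
    by (induction p rule: mpoly_single_induct)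
      (simp_all add: mpoly_scale_single mpoly_bracket_single mpoly_bracket_add_left mpoly_scale_add
         mpoly_scale_zero br.scale)
qed (simp_all add: mpoly_bracket_add_right mpoly_scale_add mpoly_scale_zero)

lemma mpoly_bracket_scale_left:
  "mpoly_bracket bracket (mpoly_scale scale c p) q = mpoly_scale scale c (mpoly_bracket bracket p q)"
proof -
  have "mpoly_scale scale c (- r) = - mpoly_scale scale c r" for r :: "('a, 'n) mpoly"
    by (rule poly_mapping_eqI) (simp add: lookup_mpoly_scale)
  then show ?thesis
    by (metis mpoly_bracket_anticomm mpoly_bracket_scale_right)
qed

lemma mpoly_scale_mult: "mpoly_scale scale c (p * q) = mpoly_scale scale c p * q"
proof (induction q rule: mpoly_single_induct)
  case (single \<beta> b)
  show ?case
    by (induction p rule: mpoly_single_induct)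
      (simp_all add: mpoly_scale_single mult_single mpoly_scale_add mpoly_scale_zero scale_mult
         distrib_right)
qed (simp_all add: mpoly_scale_add mpoly_scale_zero distrib_left)

lemma mpoly_jacobi:
  "mpoly_bracket bracket p (mpoly_bracket bracket q r) +
   mpoly_bracket bracket q (mpoly_bracket bracket r p) +
   mpoly_bracket bracket r (mpoly_bracket bracket p q) = 0" (is "?J p q r = 0")
proof (induction p rule: mpoly_single_induct)
  case (single \<alpha> a)
  show ?case
  proof (induction q rule: mpoly_single_induct)
    case (single \<beta> b)
    show ?case
    proof (induction r rule: mpoly_single_induct)
      case (single \<gamma> c)
      then show ?case
        by (simp add: mpoly_bracket_single jacobi ac_simps flip: single_add)
          (metis add.assoc add.commute jacobi single_zero)
    next
      case (add r r')
      have "?J (Poly_Mapping.single \<alpha> a) (Poly_Mapping.single \<beta> b) (r + r') =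
          ?J (Poly_Mapping.single \<alpha> a) (Poly_Mapping.single \<beta> b) r +
          ?J (Poly_Mapping.single \<alpha> a) (Poly_Mapping.single \<beta> b) r'"
        by (simp add: mpoly_bracket_add_left mpoly_bracket_add_right algebra_simps)
      then show ?case using add by simp
    qed simp
  next
    case (add q q')
    have "?J (Poly_Mapping.single \<alpha> a) (q + q') r =
        ?J (Poly_Mapping.single \<alpha> a) q r + ?J (Poly_Mapping.single \<alpha> a) q' r"
      by (simp add: mpoly_bracket_add_left mpoly_bracket_add_right algebra_simps)
    then show ?case using add by simp
  qed simp
next
  case (add p p')
  have "?J (p + p') q r = ?J p q r + ?J p' q r"
    by (simp add: mpoly_bracket_add_left mpoly_bracket_add_right algebra_simps)
  then show ?case using add by simp
qed simp

lemma mpoly_leibniz: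
  "mpoly_bracket bracket p (q * r) =
     mpoly_bracket bracket p q * r + q * mpoly_bracket bracket p r"
proof (induction p rule: mpoly_single_induct)
  case (single \<alpha> a)
  show ?case
  proof (induction q rule: mpoly_single_induct)
    case (single \<beta> b)
    show ?case
      by (induction r rule: mpoly_single_induct)
        (simp_all add: mpoly_bracket_single mult_single leibniz single_add ac_simps
          mpoly_bracket_add_right distrib_left distrib_right)
  qed (simp_all add: mpoly_bracket_add_right algebra_simps)
qed (simp_all add: mpoly_bracket_add_left algebra_simps)

lemma poisson_algebra_mpoly:
  "poisson_algebra (mpoly_scale scale :: 'k \<Rightarrow> ('a, 'n) mpoly \<Rightarrow> _) (mpoly_bracket bracket)"
proof -
  interpret V: vector_space "mpoly_scale scale :: 'k \<Rightarrow> ('a, 'n) mpoly \<Rightarrow> _"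
    by (rule vector_space_mpoly)
  show ?thesis
    by unfold_locales
      (simp_all add: mpoly_scale_mult mpoly_bracket_add_left mpoly_bracket_add_right
        mpoly_bracket_scale_left mpoly_bracket_scale_right mpoly_bracket_alternating
        mpoly_jacobi mpoly_leibniz)
qed

end

end

theory Submission
  imports Defs
begin

text \<open>
  The proof has two independent halves: an ungraded isomorphism between connected graded Poisson
  algebras that are finitely generated in degree one can be replaced by a graded one
  (\<open>graded_isomorphism\<close>), and a graded isomorphism of polynomial extensions can be cancelled
  (\<open>cancel_polynomial_variables\<close>).

  \<^bold>\<open>Regrading.\<close> Let \<open>\<phi> : A \<rightarrow> B\<close> be an ungraded isomorphism and write \<open>A\<^sub>\<le>\<^sub>d\<close>, \<open>B\<^sub>\<ge>\<^sub>d\<close> for the elements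
  of degree at most \<open>d\<close> and of order at least \<open>d\<close>. Geometrically \<open>\<phi>\<close> may move the vertex of
  the cone: the maximal ideal \<open>\<phi>\<^sup>-\<^sup>1(B\<^sub>\<ge>\<^sub>1)\<close> of \<open>A\<close> need not be the augmentation ideal. The algebra \<open>B\<close>,
  being graded, is its own associated graded algebra at \<open>B\<^sub>\<ge>\<^sub>1\<close>, while \<open>A\<close> is its own associated
  graded algebra for the filtration by degree. Both filtrations are seen on \<open>A\<close>, and the spaces
  \<open>W\<^sub>d = A\<^sub>\<le>\<^sub>d \<inter> \<phi>\<^sup>-\<^sup>1(B\<^sub>\<ge>\<^sub>d)\<close> compare them: taking the top component of \<open>w\<close> maps \<open>W\<^sub>d\<close> to \<open>A\<^sub>d\<close>, and
  taking the bottom component of \<open>\<phi> w\<close> maps \<open>W\<^sub>d\<close> to \<open>B\<^sub>d\<close>. Top components and bottom components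
  are both compatible with products and brackets, so if both maps are bijective, then the
  composites \<open>A\<^sub>d \<rightarrow> W\<^sub>d \<rightarrow> B\<^sub>d\<close> assemble to a graded Poisson isomorphism.

  Bijectivity says that the two filtrations are complementary: \<open>A = A\<^sub>\<le>\<^sub>d \<oplus> \<phi>\<^sup>-\<^sup>1(B\<^sub>\<ge>\<^sub>d\<^sub>+\<^sub>1)\<close>. The sum is
  everything (\<open>approximation\<close>) because a generator \<open>x\<close> of degree one differs by a scalar from an
  element of \<open>\<phi>\<^sup>-\<^sup>1(B\<^sub>\<ge>\<^sub>1)\<close>, so that a product of \<open>r > d\<close> generators lies in \<open>\<phi>\<^sup>-\<^sup>1(B\<^sub>\<ge>\<^sub>r)\<close> up to
  shorter products. The same argument applied to \<open>\<phi>\<^sup>-\<^sup>1\<close> gives surjections between the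
  finite-dimensional spaces \<open>A\<^sub>\<le>\<^sub>d\<close> and \<open>B\<^sub>\<le>\<^sub>d\<close> in both directions; hence these are injective, and the
  sum is direct (\<open>eq_zero_if_order_exceeds_degree\<close>).

  \<^bold>\<open>Cancellation.\<close> Polynomial extensions, graded by total degree, are again connected graded and
  finitely generated in degree one, so there is a graded isomorphism
  \<open>\<theta> : A[t\<^sub>1,\<dots>,t\<^sub>n] \<rightarrow> B[s\<^sub>1,\<dots>,s\<^sub>n]\<close>. If the Poisson center of \<open>A\<close> vanishes in degree one, then the
  central elements of degree one in \<open>A[t\<^sub>1,\<dots>,t\<^sub>n]\<close> are the \<open>n\<close>-dimensional space spanned by the \<open>t\<^sub>i\<close>. It
  contains the \<open>n\<close> linearly independent elements \<open>\<theta>\<^sup>-\<^sup>1(s\<^sub>i)\<close>, which therefore span it. Hence \<open>\<theta>\<close>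
  carries the ideal of the \<open>t\<^sub>i\<close> onto the ideal of the \<open>s\<^sub>i\<close> and induces a graded isomorphism of the
  quotients \<open>A\<close> and \<open>B\<close>.
\<close>

section \<open>Homogeneous components\<close>

context connected_graded_poisson_algebra
begin

definition component :: "nat \<Rightarrow> 'a \<Rightarrow> 'a" where
  "component i x = Poly_Mapping.lookup
     (THE f. (\<forall>i. Poly_Mapping.lookup f i \<in> grading i) \<and>
        x = (\<Sum>i\<in>Poly_Mapping.keys f. Poly_Mapping.lookup f i)) i"

lemma component_eqI:
  assumes "\<And>i. Poly_Mapping.lookup f i \<in> grading i"
    and "x = (\<Sum>i\<in>Poly_Mapping.keys f. Poly_Mapping.lookup f i)"
  shows "component i x = Poly_Mapping.lookup f i"
proof -
  have "(THE f. (\<forall>i. Poly_Mapping.lookup f i \<in> grading i) \<and>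
        x = (\<Sum>i\<in>Poly_Mapping.keys f. Poly_Mapping.lookup f i)) = f"
    using assms by (intro the1_equality[OF grading_decomposition]) blast
  then show ?thesis by (simp add: component_def)
qed

lemma component_in_grading: "component i x \<in> grading i"
proof -
  obtain f where f: "\<And>i. Poly_Mapping.lookup f i \<in> grading i"
    "x = (\<Sum>i\<in>Poly_Mapping.keys f. Poly_Mapping.lookup f i)"
    using grading_decomposition[of x] by blast
  show ?thesis using f(1)[of i] by (simp only: component_eqI[OF f])
qed

lemma finite_components: "finite {i. component i x \<noteq> 0}"
proof -
  obtain f where f: "\<And>i. Poly_Mapping.lookup f i \<in> grading i"
    "x = (\<Sum>i\<in>Poly_Mapping.keys f. Poly_Mapping.lookup f i)"
    using grading_decomposition[of x] by blast
  then have "{i. component i x \<noteq> 0} = Poly_Mapping.keys f"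
    using component_eqI[OF f] by (auto simp: in_keys_iff)
  then show ?thesis by simp
qed

lemma sum_components:
  assumes "finite I" "{i. component i x \<noteq> 0} \<subseteq> I"
  shows "(\<Sum>i\<in>I. component i x) = x"
proof -
  obtain f where f: "\<And>i. Poly_Mapping.lookup f i \<in> grading i"
    "x = (\<Sum>i\<in>Poly_Mapping.keys f. Poly_Mapping.lookup f i)"
    using grading_decomposition[of x] by blast
  then have *: "component i x = Poly_Mapping.lookup f i" for i
    by (rule component_eqI)
  then have "Poly_Mapping.keys f \<subseteq> I" using assms by (auto simp: in_keys_iff)
  then have "(\<Sum>i\<in>I. component i x) = (\<Sum>i\<in>Poly_Mapping.keys f. Poly_Mapping.lookup f i)"
    using assms by (intro sum.mono_neutral_cong_right) (auto simp: * in_keys_iff)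
  then show ?thesis using f by simp
qed

lemma component_sum:
  assumes "finite I" "\<And>i. i \<in> I \<Longrightarrow> g i \<in> grading i"
  shows "component j (\<Sum>i\<in>I. g i) = (if j \<in> I then g j else 0)"
proof -
  define f where "f = (\<Sum>i\<in>I. Poly_Mapping.single i (g i))"
  have lf: "Poly_Mapping.lookup f j = (if j \<in> I then g j else 0)" for j
    using assms by (simp add: f_def lookup_sum lookup_single when_def)
  have "Poly_Mapping.keys f \<subseteq> I"
    by (metis lf in_keys_iff subsetI)
  then have "(\<Sum>i\<in>I. g i) = (\<Sum>i\<in>Poly_Mapping.keys f. Poly_Mapping.lookup f i)"
    using assms by (intro sum.mono_neutral_cong_right) (auto simp: lf in_keys_iff)
  then show ?thesis
    using component_eqI[of f "\<Sum>i\<in>I. g i" j] assms by (simp add: lf subspace_0 subspace_grading)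
qed

lemma component_homogeneous: "x \<in> grading i \<Longrightarrow> component j x = (if j = i then x else 0)"
  using component_sum[of "{i}" "\<lambda>_. x" j] by simp

lemma component_zero [simp]: "component i 0 = 0"
  using component_sum[of "{}" "\<lambda>_. 0" i] by simp

lemma component_add: "component i (x + y) = component i x + component i y"
proof -
  let ?I = "{i. component i x \<noteq> 0} \<union> {i. component i y \<noteq> 0}"
  have fin: "finite ?I" by (simp add: finite_components)
  have "(\<Sum>j\<in>?I. component j x) = x" "(\<Sum>j\<in>?I. component j y) = y"
    by (rule sum_components[OF fin]; blast)+
  then have "x + y = (\<Sum>j\<in>?I. component j x + component j y)"
    by (simp add: sum.distrib)
  then have "component i (x + y) = (if i \<in> ?I then component i x + component i y else 0)"
    using component_sum[OF fin, of "\<lambda>j. component j x + component j y" i]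
    by (simp add: component_in_grading subspace_add subspace_grading)
  then show ?thesis by auto
qed

lemma component_scale: "component i (scale c x) = scale c (component i x)"
proof -
  let ?I = "{i. component i x \<noteq> 0}"
  have fin: "finite ?I" by (simp add: finite_components)
  have "scale c x = (\<Sum>j\<in>?I. scale c (component j x))"
    by (metis scale_sum_right sum_components[OF fin] order_refl)
  then have "component i (scale c x) = (if i \<in> ?I then scale c (component i x) else 0)"
    using component_sum[OF fin, of "\<lambda>j. scale c (component j x)" i]
    by (simp add: component_in_grading subspace_scale subspace_grading)
  then show ?thesis by auto
qed

lemma component_diff: "component i (x - y) = component i x - component i y"
  using component_add[of i "x - y" y] by simp

lemma eq_if_components_eq:
  assumes "\<And>i. component i x = component i y"
  shows "x = y"
proof -
  have "x = (\<Sum>i | component i x \<noteq> 0. component i x)"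
    by (rule sum_components[OF finite_components order_refl, symmetric])
  also have "\<dots> = (\<Sum>i | component i y \<noteq> 0. component i y)"
    by (simp only: assms)
  also have "\<dots> = y"
    by (rule sum_components[OF finite_components order_refl])
  finally show ?thesis .
qed

lemma homogeneous_induct [case_names homogeneous add]:
  assumes "\<And>i x. x \<in> grading i \<Longrightarrow> P x" "\<And>x y. P x \<Longrightarrow> P y \<Longrightarrow> P (x + y)"
  shows "P x"
proof -
  have "P (\<Sum>i\<in>I. component i x)" if "finite I" for I
    using that
  proof (induction I rule: finite_induct)
    case empty
    show ?case using assms(1)[of 0 0] by (simp add: subspace_0 subspace_grading)
  next
    case (insert i I)
    then show ?case
      by (simp add: assms(2) assms(1)[OF component_in_grading])
  qed
  from this[OF finite_components, of x] show ?thesis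
    by (simp only: sum_components[OF finite_components order_refl])
qed

text \<open>
  Abstracts what the product and the bracket have in common, so that statements about leading and
  lowest components are proved once for both.
\<close>

definition graded_biadditive :: "('a \<Rightarrow> 'a \<Rightarrow> 'a) \<Rightarrow> bool" where
  "graded_biadditive f \<longleftrightarrow>
     (\<forall>x y z. f (x + y) z = f x z + f y z) \<and> (\<forall>x y z. f x (y + z) = f x y + f x z) \<and>
     (\<forall>i j. \<forall>x\<in>grading i. \<forall>y\<in>grading j. f x y \<in> grading (i + j))"

lemma graded_biadditive_mult: "graded_biadditive (*)"
  by (simp add: graded_biadditive_def distrib_left distrib_right grading_mult)

lemma graded_biadditive_bracket: "graded_biadditive bracket"
  by (simp add: graded_biadditive_def bl.add br.add grading_bracket)

lemma graded_biadditive_zero: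
  assumes "graded_biadditive f"
  shows "f 0 y = 0" "f x 0 = 0"
  using assms unfolding graded_biadditive_def by (metis add_cancel_right_right)+

lemma component_biadditive:
  assumes "graded_biadditive f"
  shows "component d (f x y) = (\<Sum>i\<le>d. f (component i x) (component (d - i) y))"
proof (induction x rule: homogeneous_induct)
  case (homogeneous i x)
  note f0 = graded_biadditive_zero[OF assms]
  show ?case
  proof (induction y rule: homogeneous_induct)
    case y: (homogeneous j y)
    have "f x y \<in> grading (i + j)"
      using assms homogeneous y by (auto simp: graded_biadditive_def)
    moreover have "(\<Sum>k\<le>d. f (component k x) (component (d - k) y)) =
        (\<Sum>k\<le>d. if k = i then if d = i + j then f x y else 0 else 0)"
      by (rule sum.cong) (auto simp: component_homogeneous[OF homogeneous]
          component_homogeneous[OF y] f0)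
    ultimately show ?case by (simp add: component_homogeneous)
  next
    case (add y z)
    then show ?case
      using assms by (simp add: graded_biadditive_def component_add sum.distrib)
  qed
next
  case (add x z)
  then show ?case
    using assms by (simp add: graded_biadditive_def component_add sum.distrib)
qed

definition at_least :: "nat \<Rightarrow> 'a set" where
  "at_least d = {x. \<forall>i<d. component i x = 0}"

definition at_most :: "nat \<Rightarrow> 'a set" where
  "at_most d = {x. \<forall>i>d. component i x = 0}"

lemma subspace_at_least: "subspace (at_least d)"
  by (auto simp: subspace_def at_least_def component_add component_scale)

lemma subspace_at_most: "subspace (at_most d)"
  by (auto simp: subspace_def at_most_def component_add component_scale)

lemma at_least_mono: "d \<le> e \<Longrightarrow> at_least e \<subseteq> at_least d"
  by (auto simp: at_least_def)

lemma at_most_mono: "d \<le> e \<Longrightarrow> at_most d \<subseteq> at_most e"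
  by (auto simp: at_most_def)

lemma grading_at_most: "grading d \<subseteq> at_most d"
  by (auto simp: at_most_def component_homogeneous)

lemma at_least_biadditive:
  assumes "graded_biadditive f" "x \<in> at_least i" "y \<in> at_least j"
  shows "f x y \<in> at_least (i + j)" "component (i + j) (f x y) = f (component i x) (component j y)"
proof -
  note f0 = graded_biadditive_zero[OF assms(1)]
  have *: "f (component k x) (component (d - k) y) = 0" if "d \<le> i + j" "k \<le> d" "k \<noteq> i \<or> d < i + j"
    for k d
  proof (cases "k < i")
    case False
    with that have "d - k < j" by linarith
    then show ?thesis using assms(3) by (simp add: at_least_def f0)
  qed (use assms(2) in \<open>simp add: at_least_def f0\<close>)
  show "f x y \<in> at_least (i + j)"
    by (auto simp: at_least_def component_biadditive[OF assms(1)] * intro!: sum.neutral)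
  have "(\<Sum>k\<le>i + j. f (component k x) (component (i + j - k) y)) =
      (\<Sum>k\<in>{i}. f (component k x) (component (i + j - k) y))"
    by (rule sum.mono_neutral_right) (auto simp: *)
  then show "component (i + j) (f x y) = f (component i x) (component j y)"
    by (simp add: component_biadditive[OF assms(1)])
qed

lemma at_most_biadditive:
  assumes "graded_biadditive f" "x \<in> at_most i" "y \<in> at_most j"
  shows "f x y \<in> at_most (i + j)" "component (i + j) (f x y) = f (component i x) (component j y)"
proof -
  note f0 = graded_biadditive_zero[OF assms(1)]
  have *: "f (component k x) (component (d - k) y) = 0" if "d \<ge> i + j" "k \<noteq> i \<or> d > i + j"
    for k d
  proof (cases "k > i")
    case False
    with that have "d - k > j" by linarith
    then show ?thesis using assms(3) by (simp add: at_most_def f0)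
  qed (use assms(2) in \<open>simp add: at_most_def f0\<close>)
  show "f x y \<in> at_most (i + j)"
    by (auto simp: at_most_def component_biadditive[OF assms(1)] * intro!: sum.neutral)
  have "(\<Sum>k\<le>i + j. f (component k x) (component (i + j - k) y)) =
      (\<Sum>k\<in>{i}. f (component k x) (component (i + j - k) y))"
    by (rule sum.mono_neutral_right) (auto simp: *)
  then show "component (i + j) (f x y) = f (component i x) (component j y)"
    by (simp add: component_biadditive[OF assms(1)])
qed

definition truncate :: "nat \<Rightarrow> 'a \<Rightarrow> 'a" where
  "truncate d x = (\<Sum>i\<le>d. component i x)"

lemma component_truncate: "component i (truncate d x) = (if i \<le> d then component i x else 0)"
  by (simp add: truncate_def component_sum component_in_grading)

lemma truncate_eq_iff:
  assumes "w \<in> at_most d"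
  shows "truncate d x = w \<longleftrightarrow> x - w \<in> at_least (Suc d)"
proof -
  have "truncate d x = w \<longleftrightarrow> (\<forall>i. component i (truncate d x) = component i w)"
    using eq_if_components_eq by blast
  also have "\<dots> \<longleftrightarrow> (\<forall>i\<le>d. component i x = component i w)"
    using assms by (auto simp: component_truncate at_most_def)
  finally show ?thesis by (simp add: at_least_def component_diff less_Suc_eq_le)
qed

lemma truncate_in_at_most: "truncate d x \<in> at_most d"
  by (simp add: at_most_def component_truncate)

lemma linear_truncate: "Vector_Spaces.linear scale scale (truncate d)"
  by (intro Vector_Spaces.linear.intro vector_space_axioms module_hom.intro module_axioms
      module_hom_axioms.intro)
    (simp_all add: truncate_def component_add component_scale sum.distrib scale_sum_right)

lemma at_least_0: "at_least 0 = UNIV"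
  by (simp add: at_least_def)

lemma at_most_0: "at_most 0 = grading 0"
proof
  show "at_most 0 \<subseteq> grading 0"
  proof
    fix x assume "x \<in> at_most 0"
    then have "component i (component 0 x) = component i x" for i
      by (cases "i = 0")
        (auto simp: at_most_def component_homogeneous[OF component_in_grading[of 0 x]])
    then have "component 0 x = x" by (rule eq_if_components_eq)
    then show "x \<in> grading 0" using component_in_grading[of 0 x] by simp
  qed
qed (rule grading_at_most)

section \<open>Monomials in generators of degree one\<close>

fun monomials :: "'a set \<Rightarrow> nat \<Rightarrow> 'a set" where
  "monomials S 0 = {1}" |
  "monomials S (Suc r) = (\<Union>x\<in>S. (*) x ` monomials S r)"

lemma finite_monomials: "finite S \<Longrightarrow> finite (monomials S r)"
  by (induction r) auto

lemma one_in_grading_0: "1 \<in> grading 0"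
  unfolding grading_0 by (metis rangeI scale_one)

lemma monomials_in_grading: "S \<subseteq> grading 1 \<Longrightarrow> monomials S r \<subseteq> grading r"
proof (induction r)
  case (Suc r)
  then show ?case using grading_mult[of _ 1 _ r] by auto
qed (simp add: one_in_grading_0)

lemma span_mult_closed:
  assumes "\<And>x y. x \<in> X \<Longrightarrow> y \<in> Y \<Longrightarrow> x * y \<in> span Z" "x \<in> span X" "y \<in> span Y"
  shows "x * y \<in> span Z"
proof -
  have *: "x * y \<in> span Z" if "x \<in> X" for x
    using assms(3)
  proof (induction y rule: span_induct_alt)
    case (step c u v)
    then show ?case using assms(1)[OF that]
      by (simp add: distrib_left mult_scale span_add span_scale)
  qed (simp add: span_zero)
  show ?thesis using assms(2)
  proof (induction x rule: span_induct_alt)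
    case (step c u v)
    then show ?case using *
      by (simp add: distrib_right scale_mult[symmetric] span_add span_scale)
  qed (simp add: span_zero)
qed

lemma monomials_mult: "x \<in> monomials S r \<Longrightarrow> y \<in> monomials S s \<Longrightarrow> x * y \<in> monomials S (r + s)"
  by (induction r arbitrary: x) (fastforce simp: mult.assoc)+

text \<open>
  The span of all monomials is closed under products and contains the generators, so nothing
  smaller than the whole algebra is possible.
\<close>

lemma span_monomials_UNIV:
  assumes "generated_algebra scale (grading 1) = UNIV" "span S = grading 1"
  shows "span (\<Union>r. monomials S r) = UNIV"
proof -
  let ?T = "span (\<Union>r. monomials S r)"
  have "S \<subseteq> (\<Union>r. monomials S r)"
  proof
    fix x assume "x \<in> S"
    then have "x \<in> monomials S 1" by force
    then show "x \<in> (\<Union>r. monomials S r)" by blast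
  qed
  then have "grading 1 \<subseteq> ?T" using assms(2) by (metis span_mono)
  moreover have "is_subalgebra scale ?T"
    unfolding is_subalgebra_def
  proof (intro conjI ballI)
    show "1 \<in> ?T" by (rule span_base) (auto intro: exI[of _ 0])
    show "x * y \<in> ?T" if "x \<in> ?T" "y \<in> ?T" for x y
      using that(1,2) by (rule span_mult_closed[rotated]) (blast intro: span_base monomials_mult)
  qed (rule subspace_span)
  ultimately have "generated_algebra scale (grading 1) \<subseteq> ?T" by (rule hull_minimal)
  then show ?thesis by (simp only: assms(1) top.extremum_unique)
qed

text \<open>
  Taking the component of degree \<open>r\<close> of a linear combination of monomials just discards the
  monomials of every other length.
\<close>

lemma grading_eq_span_monomials:
  assumes "generated_algebra scale (grading 1) = UNIV" "span S = grading 1"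
  shows "grading r = span (monomials S r)"
proof
  have S: "S \<subseteq> grading 1" using assms(2) span_superset by blast
  have mono: "monomials S r \<subseteq> grading r" for r
    by (rule monomials_in_grading[OF S])
  show "span (monomials S r) \<subseteq> grading r"
    by (intro span_minimal mono subspace_grading)
  have "component r x \<in> span (monomials S r)" for x
  proof -
    have "x \<in> span (\<Union>r. monomials S r)" using span_monomials_UNIV[OF assms] by simp
    then show ?thesis
    proof (induction x rule: span_induct_alt)
      case (step c u v)
      then obtain s where "u \<in> monomials S s" by blast
      then have "component r u \<in> span (monomials S r)"
        using mono[of s] component_homogeneous[of u s r] by (auto simp: span_base span_zero)
      with step show ?case
        by (simp add: component_add component_scale span_add span_scale)
    qed (simp add: span_zero)
  qed
  then show "grading r \<subseteq> span (monomials S r)"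
    by (metis component_homogeneous subsetI)
qed

lemma at_most_eq_span_monomials:
  assumes "generated_algebra scale (grading 1) = UNIV" "span S = grading 1"
  shows "at_most d = span (\<Union>r\<le>d. monomials S r)"
proof
  show "at_most d \<subseteq> span (\<Union>r\<le>d. monomials S r)"
  proof
    fix x assume "x \<in> at_most d"
    then have "x = (\<Sum>r\<le>d. component r x)"
      by (intro sum_components[symmetric]) (auto simp: at_most_def not_less[symmetric])
    moreover have "component r x \<in> span (\<Union>r\<le>d. monomials S r)" if "r \<le> d" for r
    proof -
      have "component r x \<in> span (monomials S r)"
        using component_in_grading grading_eq_span_monomials[OF assms] by blast
      then show ?thesis using that span_mono[of "monomials S r" "\<Union>r\<le>d. monomials S r"] by blast
    qed
    ultimately show "x \<in> span (\<Union>r\<le>d. monomials S r)"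
      by (metis (no_types, lifting) span_sum atMost_iff)
  qed
  have "S \<subseteq> grading 1" using assms(2) span_superset by blast
  then have "monomials S r \<subseteq> at_most d" if "r \<le> d" for r
    using monomials_in_grading[of S r] grading_at_most[of r] at_most_mono[OF that] by blast
  then show "span (\<Union>r\<le>d. monomials S r) \<subseteq> at_most d"
    by (intro span_minimal subspace_at_most) blast
qed

end

section \<open>Dimension arguments in subspaces of finite dimension\<close>

text \<open>
  The subspace is finite-dimensional, while the ambient space may be an algebra of infinite
  dimension. The image of a basis spans the subspace, so counting shows that it is again a basis.
\<close>

lemma (in vector_space) inj_on_if_surj_on_finite_span:
  assumes "Vector_Spaces.linear scale scale h" "finite F" "h ` span F = span F"
  shows "inj_on h (span F)"
proof -
  interpret h: Vector_Spaces.linear scale scale h by fact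
  obtain B where B: "B \<subseteq> F" "independent B" "F \<subseteq> span B"
    using maximal_independent_subset by blast
  have fin: "finite B" using B(1) assms(2) finite_subset by blast
  have sp: "span B = span F" using B by (metis span_eq span_superset subset_trans)
  have spi: "span (h ` B) = span B" using h.span_image[of B] assms(3) sp by simp
  have d: "card B = dim (span B)" 
    using B(2) span_superset by (intro basis_card_eq_dim) auto
  have "dim (span B) \<le> card (h ` B)" using spi fin by (intro dim_le_card) auto
  then have eq: "card (h ` B) = card B" using d card_image_le[OF fin, of h] by simp
  then have inj: "inj_on h B" using fin eq_card_imp_inj_on by blast
  have "independent (h ` B)"
  proof -
    obtain C where C: "C \<subseteq> h ` B" "independent C" "h ` B \<subseteq> span C"
      using maximal_independent_subset by blast
    have "card B = card C"
      unfolding d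
    proof (rule basis_card_eq_dim[symmetric])
      show "C \<subseteq> span B" using C(1) span_superset[of "h ` B"] spi by blast
      show "span B \<subseteq> span C" using C(3) spi by (metis span_minimal subspace_span)
    qed (rule C(2))
    then have "C = h ` B" using C(1) eq fin by (intro card_subset_eq) auto
    then show ?thesis using C by simp
  qed
  then have "inj_on h (span B)"
    using inj by (intro h.inj_on_span_independent_image) 
  then show ?thesis using sp by simp
qed

lemma (in vector_space) span_eq_if_card_eq:
  assumes "finite V" "independent T" "T \<subseteq> span V" "card T = card V"
  shows "V \<subseteq> span T"
proof
  fix x assume "x \<in> V"
  show "x \<in> span T"
  proof (rule ccontr)
    assume x: "x \<notin> span T"
    then have "independent (insert x T)" using assms(2) by (rule independent_insertI)
    moreover have "insert x T \<subseteq> span V" using assms(3) \<open>x \<in> V\<close> span_base by blast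
    ultimately have "finite (insert x T) \<and> card (insert x T) \<le> card V"
      by (intro independent_span_bound[OF assms(1)])
    moreover have "x \<notin> T" using x span_base by blast
    ultimately show False using assms(4) by auto
  qed
qed

section \<open>Building graded Poisson isomorphisms\<close>

lemma poisson_iso_inv:
  assumes "poisson_iso scale bracket scale' bracket' f"
  shows "poisson_iso scale' bracket' scale bracket (inv f)"
proof -
  have bij: "bij f" and lin: "Vector_Spaces.linear scale scale' f" and one: "f 1 = 1"
    and mult: "\<And>x y. f (x * y) = f x * f y"
    and br: "\<And>x y. f (bracket x y) = bracket' (f x) (f y)"
    using assms by (auto simp: poisson_iso_def)
  interpret f: Vector_Spaces.linear scale scale' f by (rule lin)
  note inv_eq = inv_f_eq[OF bij_is_inj[OF bij]] and f_inv = surj_f_inv_f[OF bij_is_surj[OF bij]]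
  have "Vector_Spaces.linear scale' scale (inv f)"
  proof (intro Vector_Spaces.linear.intro module_hom.intro module_hom_axioms.intro)
    show "inv f (x + y) = inv f x + inv f y" for x y
      by (intro inv_eq) (simp add: f.add f_inv)
    show "inv f (scale' c x) = scale c (inv f x)" for c x
      by (intro inv_eq) (simp add: f.scale f_inv)
  qed (fact f.vs1.vector_space_axioms f.vs2.vector_space_axioms f.vs1.module_axioms
      f.vs2.module_axioms)+
  then show ?thesis
    unfolding poisson_iso_def
    by (auto intro!: inv_eq simp: bij_imp_bij_inv[OF bij] one mult br f_inv)
qed

lemma graded_poisson_isomorphic_sym:
  assumes "graded_poisson_isomorphic scale bracket grading scale' bracket' grading'"
  shows "graded_poisson_isomorphic scale' bracket' grading' scale bracket grading"
proof -
  obtain f where f: "poisson_iso scale bracket scale' bracket' f" "\<And>i. f ` grading i = grading' i"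
    using assms by (auto simp: graded_poisson_isomorphic_def)
  have "bij f" using f(1) by (simp add: poisson_iso_def)
  then have "inv f ` grading' i = grading i" for i
    by (simp add: f(2)[symmetric] image_image inv_f_f bij_is_inj)
  then show ?thesis
    using poisson_iso_inv[OF f(1)] unfolding graded_poisson_isomorphic_def by blast
qed

locale graded_poisson_pair =
  A: connected_graded_poisson_algebra scaleA bracketA gradingA +
  B: connected_graded_poisson_algebra scaleB bracketB gradingB
  for scaleA :: "'k::field \<Rightarrow> 'a::comm_ring_1 \<Rightarrow> 'a" and bracketA gradingA
    and scaleB :: "'k \<Rightarrow> 'b::comm_ring_1 \<Rightarrow> 'b" and bracketB gradingB
begin

text \<open>
  A graded isomorphism may be given degree by degree. Multiplicativity and compatibility with the
  bracket only have to be checked on homogeneous elements, as both sides are biadditive.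
\<close>

lemma graded_poisson_isomorphicI:
  fixes g :: "nat \<Rightarrow> 'a \<Rightarrow> 'b"
  assumes bij: "\<And>d. bij_betw (g d) (gradingA d) (gradingB d)"
    and add: "\<And>d x y. x \<in> gradingA d \<Longrightarrow> y \<in> gradingA d \<Longrightarrow> g d (x + y) = g d x + g d y"
    and scale: "\<And>d c x. x \<in> gradingA d \<Longrightarrow> g d (scaleA c x) = scaleB c (g d x)"
    and one: "g 0 1 = 1"
    and mult: "\<And>i j x y. x \<in> gradingA i \<Longrightarrow> y \<in> gradingA j \<Longrightarrow>
      g (i + j) (x * y) = g i x * g j y"
    and bracket: "\<And>i j x y. x \<in> gradingA i \<Longrightarrow> y \<in> gradingA j \<Longrightarrow>
      g (i + j) (bracketA x y) = bracketB (g i x) (g j y)"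
  shows "graded_poisson_isomorphic scaleA bracketA gradingA scaleB bracketB gradingB"
proof -
  define f where "f x = (\<Sum>i | A.component i x \<noteq> 0. g i (A.component i x))" for x
  have g_in: "g d x \<in> gradingB d" if "x \<in> gradingA d" for d x
    using bij_betwE[OF bij] that by blast
  have g0: "g d 0 = 0" for d
    using add[of 0 d 0] by (simp add: A.subspace_0 A.subspace_grading)
  have comp: "B.component i (f x) = g i (A.component i x)" for i x
    unfolding f_def
    by (subst B.component_sum) (auto simp: A.finite_components g0 g_in A.component_in_grading)
  have hom: "f x = g i x" if "x \<in> gradingA i" for x i
    by (rule B.eq_if_components_eq)
      (use that in \<open>simp add: comp A.component_homogeneous B.component_homogeneous[OF g_in] g0\<close>)
  have f_add: "f (x + y) = f x + f y" for x y
    by (rule B.eq_if_components_eq)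
      (simp add: comp B.component_add A.component_add add A.component_in_grading)
  have f_scale: "f (scaleA c x) = scaleB c (f x)" for c x
    by (rule B.eq_if_components_eq)
      (simp add: comp B.component_scale A.component_scale scale A.component_in_grading)
  have f_mult: "f (x * y) = f x * f y" for x y
  proof (induction x rule: A.homogeneous_induct)
    case x: (homogeneous i x)
    show ?case
    proof (induction y rule: A.homogeneous_induct)
      case (homogeneous j y)
      then show ?case using x by (simp add: hom[OF A.grading_mult] hom mult)
    qed (simp add: distrib_left f_add)
  qed (simp add: distrib_right f_add)
  have f_bracket: "f (bracketA x y) = bracketB (f x) (f y)" for x y
  proof (induction x rule: A.homogeneous_induct)
    case x: (homogeneous i x)
    show ?case
    proof (induction y rule: A.homogeneous_induct)
      case (homogeneous j y)
      then show ?case using x by (simp add: hom[OF A.grading_bracket] hom bracket)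
    qed (simp add: A.br.add B.br.add f_add)
  qed (simp add: A.bl.add B.bl.add f_add)
  have img: "f ` gradingA i = gradingB i" for i
    using bij_betw_imp_surj_on[OF bij, of i] hom by (metis image_cong)
  have "inj f"
  proof (rule injI)
    fix x y assume "f x = f y"
    then have "g i (A.component i x) = g i (A.component i y)" for i
      by (metis comp)
    then have "A.component i x = A.component i y" for i
      using bij_betw_imp_inj_on[OF bij, of i] A.component_in_grading inj_onD by metis
    then show "x = y" by (rule A.eq_if_components_eq)
  qed
  moreover have "surj f"
  proof -
    have "y \<in> range f" for y
    proof (induction y rule: B.homogeneous_induct)
      case (homogeneous i y)
      then show ?case using img[of i] by blast
    next
      case (add x y)
      then obtain u v where "x = f u" "y = f v" by blast
      then have "x + y = f (u + v)" by (simp add: f_add)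
      then show ?case by blast
    qed
    then show ?thesis by blast
  qed
  ultimately have "bij f" by (simp add: bij_def)
  moreover have "Vector_Spaces.linear scaleA scaleB f"
    by (intro Vector_Spaces.linear.intro module_hom.intro module_hom_axioms.intro f_add f_scale)
      (fact A.vector_space_axioms B.vector_space_axioms A.module_axioms B.module_axioms)+
  moreover have "f 1 = 1" using hom[OF A.one_in_grading_0] one by simp
  ultimately have "poisson_iso scaleA bracketA scaleB bracketB f"
    using f_mult f_bracket by (simp add: poisson_iso_def)
  then show ?thesis using img unfolding graded_poisson_isomorphic_def by blast
qed

end

section \<open>From ungraded to graded isomorphisms\<close>

locale ungraded_isomorphism =
  graded_poisson_pair scaleA bracketA gradingA scaleB bracketB gradingB
  for scaleA :: "'k::field \<Rightarrow> 'a::comm_ring_1 \<Rightarrow> 'a" and bracketA gradingA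
    and scaleB :: "'k \<Rightarrow> 'b::comm_ring_1 \<Rightarrow> 'b" and bracketB gradingB +
  fixes \<phi> :: "'a \<Rightarrow> 'b"
  assumes iso: "poisson_iso scaleA bracketA scaleB bracketB \<phi>"
    and genA: "finitely_generated_in_degree_one scaleA gradingA"
    and genB: "finitely_generated_in_degree_one scaleB gradingB"
begin

sublocale \<phi>: Vector_Spaces.linear scaleA scaleB \<phi>
  using iso by (simp add: poisson_iso_def)

lemma \<phi>_one: "\<phi> 1 = 1" and \<phi>_mult: "\<phi> (x * y) = \<phi> x * \<phi> y"
  and \<phi>_bracket: "\<phi> (bracketA x y) = bracketB (\<phi> x) (\<phi> y)"
  and bij_\<phi>: "bij \<phi>"
  using iso by (auto simp: poisson_iso_def)

lemma inverse_isomorphism: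
  "ungraded_isomorphism scaleB bracketB gradingB scaleA bracketA gradingA (inv \<phi>)"
  by (intro ungraded_isomorphism.intro graded_poisson_pair.intro ungraded_isomorphism_axioms.intro
      poisson_iso_inv iso genA genB)
   (fact A.connected_graded_poisson_algebra_axioms B.connected_graded_poisson_algebra_axioms)+

text \<open>
  Each generator \<open>x\<close> of degree one is \<open>x' + c\<close> with \<open>c\<close> the scalar component of \<open>\<phi> x\<close>, so that \<open>\<phi> x'\<close>
  has order at least one. Expanding a product of \<open>r\<close> generators, the product of the \<open>x'\<close> is mapped
  to order at least \<open>r\<close>, and the remaining terms involve fewer than \<open>r\<close> generators.
\<close>

lemma monomial_approximation:
  assumes S: "S \<subseteq> gradingA 1" and u: "u \<in> A.monomials S r"
  shows "\<exists>v \<in> A.span (\<Union>s<r. A.monomials S s). \<phi> (u - v) \<in> B.at_least r"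
  using u
proof (induction r arbitrary: u)
  case 0
  show ?case by (rule bexI[of _ 0]) (simp_all add: B.at_least_0 A.span_zero)
next
  case (Suc r)
  let ?M = "A.span (\<Union>s<Suc r. A.monomials S s)"
  obtain x y where xy: "u = x * y" "x \<in> S" "y \<in> A.monomials S r"
    using Suc.prems by auto
  obtain v where v: "v \<in> A.span (\<Union>s<r. A.monomials S s)" "\<phi> (y - v) \<in> B.at_least r"
    using Suc.IH[OF xy(3)] by blast
  obtain c where c: "B.component 0 (\<phi> x) = scaleB c 1"
    using B.component_in_grading[of 0 "\<phi> x"] B.grading_0 by auto
  define x' where "x' = x - scaleA c 1"
  have "\<phi> x' = \<phi> x - B.component 0 (\<phi> x)"
    by (simp add: x'_def \<phi>.diff \<phi>.scale \<phi>_one c)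
  then have x': "\<phi> x' \<in> B.at_least 1"
    by (simp add: B.at_least_def B.component_diff
        B.component_homogeneous[OF B.component_in_grading])
  \<comment> \<open>Replacing \<open>y\<close> by \<open>y - v\<close> and \<open>x\<close> by \<open>x'\<close> in the product \<open>x * y\<close> leaves this remainder.\<close>
  define w where "w = scaleA c (y - v) + x * v"
  have "u - w = x' * (y - v)"
    by (simp add: xy w_def x'_def algebra_simps A.mult_scale)
  then have "\<phi> (u - w) = \<phi> x' * \<phi> (y - v)" by (simp add: \<phi>_mult)
  then have "\<phi> (u - w) \<in> B.at_least (Suc r)"
    using B.at_least_biadditive(1)[OF B.graded_biadditive_mult x' v(2)] by simp
  moreover have "w \<in> ?M"
  proof -
    have "v \<in> ?M" using v(1) A.span_mono[of "\<Union>s<r. A.monomials S s" "\<Union>s<Suc r. A.monomials S s"]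
      by force
    moreover have "y \<in> ?M" using xy(3) by (intro A.span_base) blast
    moreover have "x * v \<in> ?M"
    proof (rule A.span_mult_closed[of "{x}" "\<Union>s<r. A.monomials S s"])
      fix a b assume "a \<in> {x}" "b \<in> (\<Union>s<r. A.monomials S s)"
      then obtain s where "s < r" "b \<in> A.monomials S s" "a = x" by blast
      then have "a * b \<in> A.monomials S (Suc s)" using xy(2) by auto
      then show "a * b \<in> ?M" using \<open>s < r\<close> by (intro A.span_base) blast
    qed (use v(1) in \<open>auto intro: A.span_base\<close>)
    ultimately show ?thesis
      unfolding w_def by (intro A.span_add A.span_scale A.span_diff)
  qed
  ultimately show ?case by blast
qed

text \<open>
  Monomials of length at most \<open>d\<close> approximate themselves; a longer one is already mapped to high
  order after subtracting shorter monomials, which are covered by induction on the length.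
\<close>

lemma approximation:
  "\<exists>w \<in> A.at_most d. \<phi> (x - w) \<in> B.at_least (Suc d)"
proof -
  obtain S where S: "A.span S = gradingA 1"
    using genA by (auto simp: finitely_generated_in_degree_one_def)
  have gen: "generated_algebra scaleA (gradingA 1) = UNIV"
    using genA by (simp add: finitely_generated_in_degree_one_def)
  have S1: "S \<subseteq> gradingA 1" using S A.span_superset by blast
  define U where "U = {x. \<exists>w \<in> A.at_most d. \<phi> (x - w) \<in> B.at_least (Suc d)}"
  have sub: "A.subspace U"
  proof (rule A.subspaceI)
    show "0 \<in> U"
      using A.subspace_0[OF A.subspace_at_most] B.subspace_0[OF B.subspace_at_least]
      by (auto simp: U_def intro!: bexI[of _ 0])
    show "x + y \<in> U" if "x \<in> U" "y \<in> U" for x y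
    proof -
      from that obtain v w where vw: "v \<in> A.at_most d" "\<phi> (x - v) \<in> B.at_least (Suc d)"
        "w \<in> A.at_most d" "\<phi> (y - w) \<in> B.at_least (Suc d)" by (auto simp: U_def)
      have "\<phi> (x - v) + \<phi> (y - w) \<in> B.at_least (Suc d)"
        using vw by (intro B.subspace_add[OF B.subspace_at_least])
      then have "\<phi> (x + y - (v + w)) \<in> B.at_least (Suc d)"
        by (simp add: \<phi>.add \<phi>.diff algebra_simps)
      moreover have "v + w \<in> A.at_most d"
        using vw by (intro A.subspace_add[OF A.subspace_at_most])
      ultimately show ?thesis by (auto simp: U_def)
    qed
    show "scaleA c x \<in> U" if "x \<in> U" for c x
    proof -
      from that obtain v where v: "v \<in> A.at_most d" "\<phi> (x - v) \<in> B.at_least (Suc d)"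
        by (auto simp: U_def)
      have "\<phi> (scaleA c x - scaleA c v) \<in> B.at_least (Suc d)"
        using B.subspace_scale[OF B.subspace_at_least v(2), of c]
        by (simp add: \<phi>.scale A.scale_right_diff_distrib[symmetric])
      moreover have "scaleA c v \<in> A.at_most d"
        using v by (intro A.subspace_scale[OF A.subspace_at_most])
      ultimately show ?thesis by (auto simp: U_def)
    qed
  qed
  have "A.monomials S r \<subseteq> U" for r
  proof (induction r rule: less_induct)
    case (less r)
    show ?case
    proof
      fix u assume u: "u \<in> A.monomials S r"
      show "u \<in> U"
      proof (cases "r \<le> d")
        case True
        have "u \<in> A.at_most d"
          using A.monomials_in_grading[OF S1, of r] A.grading_at_most[of r] A.at_most_mono[OF True] u by blast
        then show ?thesis using B.subspace_0[OF B.subspace_at_least]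
          by (auto simp: U_def intro!: bexI[of _ u])
      next
        case False
        obtain v where v: "v \<in> A.span (\<Union>s<r. A.monomials S s)" "\<phi> (u - v) \<in> B.at_least r"
          using monomial_approximation[OF S1 u] by blast
        have "A.span (\<Union>s<r. A.monomials S s) \<subseteq> U"
          using less.IH by (intro A.span_minimal sub) blast
        then have "v \<in> U" using v by blast
        moreover have "u - v \<in> U"
          using v(2) B.at_least_mono[of "Suc d" r] False A.subspace_0[OF A.subspace_at_most]
          by (auto simp: U_def intro!: bexI[of _ 0])
        ultimately show ?thesis using A.subspace_add[OF sub, of "u - v" v] by simp
      qed
    qed
  qed
  then have "A.span (\<Union>r. A.monomials S r) \<subseteq> U"
    by (intro A.span_minimal sub) blast
  then have "x \<in> U" using A.span_monomials_UNIV[OF gen S] by blast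
  then show ?thesis by (simp add: U_def)
qed

text \<open>
  By approximation for \<open>\<phi>\<close> and for its inverse, the composite
  \<open>A\<^sub>\<le>\<^sub>d \<rightarrow> B\<^sub>\<le>\<^sub>d \<rightarrow> A\<^sub>\<le>\<^sub>d\<close> of the truncated maps \<open>\<phi>\<close> and \<open>\<phi>\<^sup>-\<^sup>1\<close> is surjective. The space is
  finite-dimensional, hence the composite is injective; but it kills \<open>w\<close>.
\<close>

lemma eq_zero_if_order_exceeds_degree:
  assumes w: "w \<in> A.at_most d" "\<phi> w \<in> B.at_least (Suc d)"
  shows "w = 0"
proof -
  interpret inv: ungraded_isomorphism scaleB bracketB gradingB scaleA bracketA gradingA "inv \<phi>"
    by (rule inverse_isomorphism)
  define h where "h x = A.truncate d (inv \<phi> (B.truncate d (\<phi> x)))" for x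
  have lin: "Vector_Spaces.linear scaleA scaleA h"
    using Vector_Spaces.linear_compose[OF Vector_Spaces.linear_compose[OF
        Vector_Spaces.linear_compose[OF \<phi>.linear_axioms B.linear_truncate]
        inv.\<phi>.linear_axioms] A.linear_truncate, of d d]
    by (simp add: h_def[abs_def] comp_def)
  have h_eqI: "h v = x"
    if "x \<in> A.at_most d" "b \<in> B.at_most d"
      "inv \<phi> b - x \<in> A.at_least (Suc d)" "\<phi> v - b \<in> B.at_least (Suc d)" for v x b
    using that by (simp add: h_def A.truncate_eq_iff[of x, THEN iffD2]
        B.truncate_eq_iff[of b, THEN iffD2])
  have img: "h ` A.at_most d = A.at_most d"
  proof
    show "h ` A.at_most d \<subseteq> A.at_most d" by (auto simp: h_def A.truncate_in_at_most)
    show "A.at_most d \<subseteq> h ` A.at_most d"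
    proof
      fix x assume x: "x \<in> A.at_most d"
      obtain b where b: "b \<in> B.at_most d" "inv \<phi> (\<phi> x - b) \<in> A.at_least (Suc d)"
        using inv.approximation[of d "\<phi> x"] by blast
      obtain v where v: "v \<in> A.at_most d" "\<phi> (inv \<phi> b - v) \<in> B.at_least (Suc d)"
        using approximation[of d "inv \<phi> b"] by blast
      have "h v = x"
        using x b(1) A.subspace_neg[OF A.subspace_at_least b(2)]
          B.subspace_neg[OF B.subspace_at_least v(2)]
        by (intro h_eqI) (simp_all add: \<phi>.diff inv.\<phi>.diff inv_f_f bij_is_inj bij_\<phi>
            surj_f_inv_f bij_is_surj)
      then show "x \<in> h ` A.at_most d" using v by blast
    qed
  qed
  obtain S where S: "finite S" "A.span S = gradingA 1"
    using genA by (auto simp: finitely_generated_in_degree_one_def)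
  have gen: "generated_algebra scaleA (gradingA 1) = UNIV"
    using genA by (simp add: finitely_generated_in_degree_one_def)
  note at_most = A.at_most_eq_span_monomials[OF gen S(2), of d]
  have "inj_on h (A.at_most d)"
    using img unfolding at_most
    by (intro A.inj_on_if_surj_on_finite_span[OF lin]) (simp_all add: A.finite_monomials S)
  moreover have zero: "0 \<in> A.at_most d" "0 \<in> B.at_most d"
    by (simp_all add: A.subspace_0 B.subspace_0 A.subspace_at_most B.subspace_at_most)
  moreover have "h w = 0"
    using w(2) zero A.subspace_0[OF A.subspace_at_least]
    by (intro h_eqI[where b = 0]) (simp_all add: inv.\<phi>.zero)
  moreover have "h 0 = 0"
    using zero A.subspace_0[OF A.subspace_at_least] B.subspace_0[OF B.subspace_at_least]
    by (intro h_eqI[where b = 0]) (simp_all add: inv.\<phi>.zero \<phi>.zero)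
  ultimately show ?thesis using w(1) inj_onD by metis
qed

text \<open>
  For \<open>w \<noteq> 0\<close> the order of \<open>\<phi> w\<close> in \<open>B\<close> never exceeds the degree of \<open>w\<close> in \<open>A\<close>. A nonzero \<open>w\<close> is in
  \<open>aligned d\<close> exactly when both are equal to \<open>d\<close>; so both its top component and the lowest component
  of its image are nonzero of degree \<open>d\<close>.
\<close>

definition aligned :: "nat \<Rightarrow> 'a set" where
  "aligned d = {w \<in> A.at_most d. \<phi> w \<in> B.at_least d}"

lemma subspace_aligned: "A.subspace (aligned d)"
  using A.subspace_at_most[of d] B.subspace_at_least[of d]
  by (auto simp: aligned_def A.subspace_def B.subspace_def \<phi>.add \<phi>.scale \<phi>.zero)

text \<open>
  An aligned element without component of degree \<open>d\<close> has degree below \<open>d\<close> and is mapped to order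
  at least \<open>d\<close>, so it vanishes. Conversely, subtracting from \<open>a\<close> of degree \<open>d\<close> an approximation of
  degree below \<open>d\<close> yields an aligned element with the same top component.
\<close>

lemma bij_betw_aligned_source: "bij_betw (A.component d) (aligned d) (gradingA d)"
proof -
  have "w = 0" if "w \<in> aligned d" "A.component d w = 0" for w
  proof (cases d)
    case 0
    then have "A.component i w = A.component i 0" for i
      using that by (cases "i = 0") (auto simp: aligned_def A.at_most_def)
    then show ?thesis by (rule A.eq_if_components_eq)
  next
    case (Suc e)
    have "A.component i w = 0" if "e < i" for i
      using \<open>w \<in> aligned d\<close> \<open>A.component d w = 0\<close> that Suc
      by (cases "i = d") (auto simp: aligned_def A.at_most_def)
    then have "w \<in> A.at_most e" by (simp add: A.at_most_def)
    then show ?thesis using that Suc eq_zero_if_order_exceeds_degree[of w e]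
      by (auto simp: aligned_def)
  qed
  then have inj: "inj_on (A.component d) (aligned d)"
    using A.subspace_diff[OF subspace_aligned, of _ d]
    by (intro inj_onI) (metis A.component_diff right_minus_eq)
  have "a \<in> A.component d ` aligned d" if a: "a \<in> gradingA d" for a
  proof (cases d)
    case 0
    then have "a \<in> aligned d" "A.component d a = a"
      using a by (auto simp: aligned_def B.at_least_0 A.at_most_0 A.component_homogeneous)
    then show ?thesis by force
  next
    case (Suc e)
    obtain v where v: "v \<in> A.at_most e" "\<phi> (a - v) \<in> B.at_least (Suc e)"
      using approximation[of e a] by blast
    have "a - v \<in> aligned d"
      using v a A.grading_at_most[of d] A.at_most_mono[of e d] Suc
      by (auto simp: aligned_def intro!: A.subspace_diff[OF A.subspace_at_most])
    moreover have "A.component d (a - v) = a"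
      using v a Suc by (simp add: A.component_diff A.component_homogeneous A.at_most_def)
    ultimately show ?thesis by force
  qed
  then show ?thesis
    using inj A.component_in_grading by (auto simp: bij_betw_def)
qed

text \<open>
  The mirror image for lowest components: if that of \<open>\<phi> w\<close> vanishes, then the order of \<open>\<phi> w\<close>
  exceeds the degree of \<open>w\<close>; and an approximation up to degree \<open>d\<close> of the preimage of \<open>b\<close> has an
  image with lowest component \<open>b\<close>.
\<close>

lemma bij_betw_aligned_target:
  "bij_betw (\<lambda>w. B.component d (\<phi> w)) (aligned d) (gradingB d)"
proof -
  have "w = 0" if "w \<in> aligned d" "B.component d (\<phi> w) = 0" for w
  proof -
    have "\<phi> w \<in> B.at_least (Suc d)"
      using that by (auto simp: aligned_def B.at_least_def less_Suc_eq)
    then show ?thesis using that eq_zero_if_order_exceeds_degree[of w d] by (simp add: aligned_def)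
  qed
  then have inj: "inj_on (\<lambda>w. B.component d (\<phi> w)) (aligned d)"
    using A.subspace_diff[OF subspace_aligned, of _ d]
    by (intro inj_onI) (metis B.component_diff \<phi>.diff right_minus_eq)
  have "b \<in> (\<lambda>w. B.component d (\<phi> w)) ` aligned d" if b: "b \<in> gradingB d" for b
  proof -
    obtain w where w: "w \<in> A.at_most d" "\<phi> (inv \<phi> b - w) \<in> B.at_least (Suc d)"
      using approximation[of d "inv \<phi> b"] by blast
    then have "b - \<phi> w \<in> B.at_least (Suc d)"
      by (simp add: \<phi>.diff surj_f_inv_f bij_is_surj bij_\<phi>)
    then have "B.component i (\<phi> w) = B.component i b" if "i \<le> d" for i
      using that by (auto simp: B.at_least_def B.component_diff less_Suc_eq_le)
    then have "w \<in> aligned d" "B.component d (\<phi> w) = b"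
      using w b by (auto simp: aligned_def B.at_least_def B.component_homogeneous)
    then show ?thesis by force
  qed
  then show ?thesis
    using inj B.component_in_grading by (auto simp: bij_betw_def)
qed

text \<open>
  In degree \<open>d\<close> the isomorphism lifts \<open>a\<close> to the aligned element with top component \<open>a\<close> and takes
  the lowest component of its image. Products and brackets of aligned elements are aligned in the sum
  of the degrees, and there both top and lowest components are computed from those of the factors.
\<close>

theorem graded_isomorphism:
  "graded_poisson_isomorphic scaleA bracketA gradingA scaleB bracketB gradingB"
proof -
  define r where "r d = inv_into (aligned d) (A.component d)" for d
  define g where "g d a = B.component d (\<phi> (r d a))" for d a
  have r: "r d a \<in> aligned d" "A.component d (r d a) = a" if "a \<in> gradingA d" for d a
    using bij_betw_inv_into[OF bij_betw_aligned_source] bij_betw_inv_into_right[OF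
      bij_betw_aligned_source] that bij_betwE unfolding r_def by blast+
  have g_eqI: "g d a = B.component d (\<phi> w)" if "w \<in> aligned d" "A.component d w = a" for d a w
    using bij_betw_inv_into_left[OF bij_betw_aligned_source that(1)] that(2)
    by (simp add: g_def r_def)
  have biadditive: "g (i + j) (f x y) = f' (g i x) (g j y)"
    if "A.graded_biadditive f" "B.graded_biadditive f'" "\<And>x y. \<phi> (f x y) = f' (\<phi> x) (\<phi> y)"
      "x \<in> gradingA i" "y \<in> gradingA j" for f f' i j x y
  proof -
    note rx = r[OF that(4)] and ry = r[OF that(5)]
    have "f (r i x) (r j y) \<in> aligned (i + j)"
      using rx(1) ry(1) by (auto simp: aligned_def that(3)
          intro: A.at_most_biadditive(1)[OF that(1)] B.at_least_biadditive(1)[OF that(2)])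
    moreover have "A.component (i + j) (f (r i x) (r j y)) = f x y"
      using rx ry by (subst A.at_most_biadditive(2)[OF that(1)]) (auto simp: aligned_def)
    ultimately have "g (i + j) (f x y) = B.component (i + j) (\<phi> (f (r i x) (r j y)))"
      by (rule g_eqI)
    also have "\<dots> = f' (g i x) (g j y)"
      using rx ry unfolding that(3) g_def
      by (subst B.at_least_biadditive(2)[OF that(2)]) (auto simp: aligned_def)
    finally show ?thesis .
  qed
  show ?thesis
  proof (rule graded_poisson_isomorphicI)
    show "bij_betw (g d) (gradingA d) (gradingB d)" for d
      using bij_betw_trans[OF bij_betw_inv_into[OF bij_betw_aligned_source]
          bij_betw_aligned_target[of d]]
      by (simp add: g_def[abs_def] r_def comp_def)
    show "g d (x + y) = g d x + g d y" if "x \<in> gradingA d" "y \<in> gradingA d" for d x y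
      using r[OF that(1)] r[OF that(2)]
      by (subst g_eqI[of "r d x + r d y"])
        (simp_all add: A.subspace_add[OF subspace_aligned] A.component_add \<phi>.add
          B.component_add g_def)
    show "g d (scaleA c x) = scaleB c (g d x)" if "x \<in> gradingA d" for d c x
      using r[OF that]
      by (subst g_eqI[of "scaleA c (r d x)"])
        (simp_all add: A.subspace_scale[OF subspace_aligned] A.component_scale \<phi>.scale
          B.component_scale g_def)
    show "g 0 1 = 1"
      by (subst g_eqI[of 1]) (simp_all add: aligned_def A.at_most_0 B.at_least_0
          A.one_in_grading_0 A.component_homogeneous[OF A.one_in_grading_0]
          B.component_homogeneous[OF B.one_in_grading_0]
          \<phi>_one)
    show "g (i + j) (x * y) = g i x * g j y" if "x \<in> gradingA i" "y \<in> gradingA j" for i j x y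
      using biadditive[OF A.graded_biadditive_mult B.graded_biadditive_mult \<phi>_mult that] .
    show "g (i + j) (bracketA x y) = bracketB (g i x) (g j y)"
      if "x \<in> gradingA i" "y \<in> gradingA j" for i j x y
      using biadditive[OF A.graded_biadditive_bracket B.graded_biadditive_bracket \<phi>_bracket that] .
  qed
qed

end

section \<open>Polynomial extensions graded by total degree\<close>

definition total_degree :: "('n::finite \<Rightarrow>\<^sub>0 nat) \<Rightarrow> nat" where
  "total_degree \<alpha> = (\<Sum>i\<in>UNIV. Poly_Mapping.lookup \<alpha> i)"

lemma total_degree_add: "total_degree (\<alpha> + \<beta>) = total_degree \<alpha> + total_degree \<beta>"
  by (simp add: total_degree_def lookup_add sum.distrib)

lemma total_degree_single [simp]: "total_degree (Poly_Mapping.single i k) = k"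
  by (simp add: total_degree_def lookup_single when_def)

lemma total_degree_zero [simp]: "total_degree 0 = 0"
  by (simp add: total_degree_def)

lemma total_degree_eq_0_iff [simp]: "total_degree \<alpha> = 0 \<longleftrightarrow> \<alpha> = 0"
  by (auto simp: total_degree_def intro: poly_mapping_eqI)

lemma exponent_add_eq_0_iff [simp]:
  fixes \<alpha> \<beta> :: "'n::finite \<Rightarrow>\<^sub>0 nat"
  shows "\<alpha> + \<beta> = 0 \<longleftrightarrow> \<alpha> = 0 \<and> \<beta> = 0"
  by (metis add_is_0 total_degree_add total_degree_eq_0_iff)

lemma exponent_split:
  fixes \<alpha> :: "'n::finite \<Rightarrow>\<^sub>0 nat"
  assumes "\<alpha> \<noteq> 0"
  obtains i \<beta> where "\<alpha> = Poly_Mapping.single i 1 + \<beta>"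
proof -
  obtain i where "Poly_Mapping.lookup \<alpha> i \<noteq> 0"
    using assms poly_mapping_eqI[of \<alpha> 0] by auto
  then have "\<alpha> = Poly_Mapping.single i 1 + (\<alpha> - Poly_Mapping.single i 1)"
    by (intro poly_mapping_eqI) (auto simp: lookup_add lookup_minus lookup_single when_def)
  then show ?thesis by (rule that)
qed

lemma total_degree_eq_1:
  assumes "total_degree \<alpha> = 1"
  obtains i where "\<alpha> = Poly_Mapping.single i 1"
proof -
  have "\<alpha> \<noteq> 0" using assms by auto
  then obtain i \<beta> where "\<alpha> = Poly_Mapping.single i 1 + \<beta>" by (rule exponent_split)
  with assms have "\<beta> = 0" by (simp add: total_degree_add)
  with \<open>\<alpha> = _\<close> show ?thesis using that by simp
qed

definition mpoly_var :: "'n \<Rightarrow> ('a::comm_ring_1, 'n) mpoly" where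
  "mpoly_var i = Poly_Mapping.single (Poly_Mapping.single i 1) 1"

definition constant_term :: "('a::comm_ring_1, 'n) mpoly \<Rightarrow> 'a" where
  "constant_term p = Poly_Mapping.lookup p 0"

lemma constant_term_simps [simp]:
  "constant_term 0 = 0"
  "constant_term (p + q) = constant_term p + constant_term q"
  "constant_term (p - q) = constant_term p - constant_term q"
  "constant_term (Poly_Mapping.single \<alpha> a) = (if \<alpha> = 0 then a else 0)"
  "constant_term (mpoly_var i) = 0"
  by (auto simp: constant_term_def lookup_add lookup_minus lookup_single when_def mpoly_var_def
      dest: arg_cong[where f = "\<lambda>\<alpha>. Poly_Mapping.lookup \<alpha> i"])

lemma constant_term_one: "constant_term 1 = 1"
  by (simp add: constant_term_def lookup_one)

lemma constant_term_mult:
  fixes p q :: "('a::comm_ring_1, 'n::finite) mpoly"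
  shows "constant_term (p * q) = constant_term p * constant_term q"
proof (induction p rule: mpoly_single_induct)
  case (single \<alpha> a)
  show ?case
    by (induction q rule: mpoly_single_induct) (simp_all add: mult_single distrib_left)
qed (simp_all add: distrib_right)

lemma mpoly_as_sum:
  "p = (\<Sum>\<alpha>\<in>Poly_Mapping.keys p. Poly_Mapping.single \<alpha> (Poly_Mapping.lookup p \<alpha>))"
  by (rule poly_mapping_eqI) (simp add: lookup_sum lookup_single when_def in_keys_iff)

text \<open>
  The polynomials without constant term form the ideal generated by the variables, and the constant
  term is multiplicative. So a multiplicative map preserves this ideal as soon as it sends the
  variables into it.
\<close>

lemma constant_term_eq_0_if_vars:
  fixes F :: "('a::comm_ring_1, 'n::finite) mpoly \<Rightarrow> ('b::comm_ring_1, 'n) mpoly"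
  assumes add: "\<And>p q. F (p + q) = F p + F q" and mult: "\<And>p q. F (p * q) = F p * F q"
    and vars: "\<And>i. constant_term (F (mpoly_var i)) = 0"
    and p: "constant_term p = 0"
  shows "constant_term (F p) = 0"
proof -
  have F0: "F 0 = 0" using add[of 0 0] by simp
  have single: "constant_term (F (Poly_Mapping.single \<alpha> a)) = 0" if "\<alpha> \<noteq> 0" for \<alpha> a
  proof -
    obtain i \<beta> where "\<alpha> = Poly_Mapping.single i 1 + \<beta>" using exponent_split[OF \<open>\<alpha> \<noteq> 0\<close>] .
    then have "Poly_Mapping.single \<alpha> a = mpoly_var i * Poly_Mapping.single \<beta> a"
      by (simp add: mpoly_var_def mult_single)
    then show ?thesis by (simp add: mult constant_term_mult vars)
  qed
  have sum: "constant_term (F (\<Sum>\<alpha>\<in>K. Poly_Mapping.single \<alpha> (Poly_Mapping.lookup p \<alpha>))) = 0"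
    if "finite K" "0 \<notin> K" for K
    using that
  proof (induction K rule: finite_induct)
    case (insert \<alpha> K)
    then show ?case by (auto simp: add single)
  qed (simp add: F0)
  have "0 \<notin> Poly_Mapping.keys p" using p by (simp add: constant_term_def in_keys_iff)
  from sum[OF finite_keys this] show ?thesis by (simp flip: mpoly_as_sum)
qed

definition mpoly_grading :: "(nat \<Rightarrow> 'a::comm_ring_1 set) \<Rightarrow> nat \<Rightarrow> ('a, 'n::finite) mpoly set" where
  "mpoly_grading grading d = {p. \<forall>\<alpha>\<in>Poly_Mapping.keys p.
     total_degree \<alpha> \<le> d \<and> Poly_Mapping.lookup p \<alpha> \<in> grading (d - total_degree \<alpha>)}"

context connected_graded_poisson_algebra
begin

lemma constant_term_bracket:
  fixes p q :: "('a, 'n::finite) mpoly"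
  shows "constant_term (mpoly_bracket bracket p q) = bracket (constant_term p) (constant_term q)"
proof (induction p rule: mpoly_single_induct)
  case (single \<alpha> a)
  show ?case
    by (induction q rule: mpoly_single_induct)
      (simp_all add: mpoly_bracket_single mpoly_bracket_add_right br.add br.zero bl.zero)
qed (simp_all add: mpoly_bracket_add_left bl.add bl.zero)

lemma constant_term_scale: "constant_term (mpoly_scale scale c p) = scale c (constant_term p)"
  by (simp add: constant_term_def lookup_mpoly_scale)

lemma in_mpoly_grading_iff:
  "p \<in> mpoly_grading grading d \<longleftrightarrow>
     (\<forall>\<alpha>. Poly_Mapping.lookup p \<alpha> \<in> (if total_degree \<alpha> \<le> d then grading (d - total_degree \<alpha>) else {0}))"
  unfolding mpoly_grading_def by (auto simp: in_keys_iff subspace_0 subspace_grading)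

lemma constant_term_in_grading: "p \<in> mpoly_grading grading d \<Longrightarrow> constant_term p \<in> grading d"
  by (auto simp: in_mpoly_grading_iff constant_term_def dest: spec[of _ 0])

lemma single_in_mpoly_grading:
  "a \<in> grading i \<Longrightarrow> Poly_Mapping.single \<alpha> a \<in> mpoly_grading grading (total_degree \<alpha> + i)"
  by (auto simp: mpoly_grading_def)

lemma mpoly_grading_induct [consumes 1, case_names zero single add]:
  assumes p: "p \<in> mpoly_grading grading d"
    and zero: "P 0"
    and single: "\<And>\<alpha> a i. a \<in> grading i \<Longrightarrow> total_degree \<alpha> + i = d \<Longrightarrow> P (Poly_Mapping.single \<alpha> a)"
    and add: "\<And>p q. P p \<Longrightarrow> P q \<Longrightarrow> P (p + q)"
  shows "P p"
proof -
  have "P (\<Sum>\<alpha>\<in>K. Poly_Mapping.single \<alpha> (Poly_Mapping.lookup p \<alpha>))"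
    if "finite K" "K \<subseteq> Poly_Mapping.keys p" for K
    using that
  proof (induction K rule: finite_induct)
    case (insert \<alpha> K)
    then have "P (Poly_Mapping.single \<alpha> (Poly_Mapping.lookup p \<alpha>))"
      using p by (intro single[of _ "d - total_degree \<alpha>"]) (auto simp: mpoly_grading_def)
    then show ?case using insert by (simp add: add)
  qed (simp add: zero)
  from this[OF finite_keys order_refl] show ?thesis by (simp flip: mpoly_as_sum)
qed

lemma subspace_mpoly_grading:
  "module.subspace (mpoly_scale scale) (mpoly_grading grading d :: ('a, 'n::finite) mpoly set)"
proof -
  interpret M: vector_space "mpoly_scale scale :: 'k \<Rightarrow> ('a, 'n) mpoly \<Rightarrow> _"
    by (rule vector_space_mpoly)
  define V where "V \<alpha> = (if total_degree \<alpha> \<le> d then grading (d - total_degree \<alpha>) else {0})"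
    for \<alpha> :: "'n \<Rightarrow>\<^sub>0 nat"
  have "subspace (V \<alpha>)" for \<alpha>
    by (simp add: V_def subspace_grading)
  then show ?thesis
    by (auto simp: M.subspace_def in_mpoly_grading_iff lookup_add lookup_mpoly_scale
        simp flip: V_def intro: subspace_0 subspace_add subspace_scale)
qed

lemma mpoly_grading_biadditive:
  fixes F :: "('a, 'n::finite) mpoly \<Rightarrow> ('a, 'n) mpoly \<Rightarrow> ('a, 'n) mpoly"
  assumes f: "graded_biadditive f"
    and add: "\<And>p q r. F (p + q) r = F p r + F q r" "\<And>p q r. F p (q + r) = F p q + F p r"
    and single: "\<And>\<alpha> \<beta> a b. F (Poly_Mapping.single \<alpha> a) (Poly_Mapping.single \<beta> b) =
      Poly_Mapping.single (\<alpha> + \<beta>) (f a b)"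
    and p: "p \<in> mpoly_grading grading d" and q: "q \<in> mpoly_grading grading e"
  shows "F p q \<in> mpoly_grading grading (d + e)"
proof -
  interpret M: vector_space "mpoly_scale scale :: 'k \<Rightarrow> ('a, 'n::finite) mpoly \<Rightarrow> _"
    by (rule vector_space_mpoly)
  have F0: "F 0 r = 0" "F r 0 = 0" for r
    using add(1)[of 0 0 r] add(2)[of r 0 0] by simp_all
  note sub = subspace_mpoly_grading[of "d + e"]
  show ?thesis using p
  proof (induction p rule: mpoly_grading_induct)
    case s: (single \<alpha> a i)
    show ?case using q
    proof (induction q rule: mpoly_grading_induct)
      case (single \<beta> b j)
      have "f a b \<in> grading (i + j)" using f s(1) single(1) by (auto simp: graded_biadditive_def)
      from single_in_mpoly_grading[OF this, of "\<alpha> + \<beta>"] show ?case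
        using s(2) single(2)
        by (simp add: assms(4) total_degree_add) (metis add.assoc add.left_commute)
    qed (simp_all add: F0 add M.subspace_0[OF sub] M.subspace_add[OF sub])
  qed (simp_all add: F0 add M.subspace_0[OF sub] M.subspace_add[OF sub])
qed

text \<open>
  This formula forces the homogeneous components of a polynomial to be unique: the coefficient at
  \<open>\<alpha>\<close> of the component of degree \<open>d\<close> is the component of degree \<open>d - |\<alpha>|\<close> of the coefficient at
  \<open>\<alpha>\<close>.
\<close>

lemma lookup_sum_homogeneous:
  assumes f: "\<And>i. Poly_Mapping.lookup f i \<in> mpoly_grading grading i"
    and p: "p = (\<Sum>i\<in>Poly_Mapping.keys f. Poly_Mapping.lookup f i)"
  shows "Poly_Mapping.lookup (Poly_Mapping.lookup f d) \<alpha> =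
    (if total_degree \<alpha> \<le> d then component (d - total_degree \<alpha>) (Poly_Mapping.lookup p \<alpha>) else 0)"
proof (cases "total_degree \<alpha> \<le> d")
  case True
  let ?c = "\<lambda>i. Poly_Mapping.lookup (Poly_Mapping.lookup f i) \<alpha>"
  have "component (d - total_degree \<alpha>) (?c i) = (if i = d then ?c d else 0)" for i
  proof (cases "total_degree \<alpha> \<le> i")
    case le: True
    then have "?c i \<in> grading (i - total_degree \<alpha>)"
      using f[of i] by (auto simp: in_mpoly_grading_iff split: if_splits dest: spec[of _ \<alpha>])
    then show ?thesis using True le by (auto simp: component_homogeneous)
  next
    case False
    then have "?c i = 0"
      using f[of i] by (auto simp: in_mpoly_grading_iff split: if_splits dest: spec[of _ \<alpha>])
    then show ?thesis using False True by auto
  qed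
  moreover have "component e (\<Sum>i\<in>K. ?c i) = (\<Sum>i\<in>K. component e (?c i))" if "finite K" for K e
    using that by (induction K rule: finite_induct) (simp_all add: component_add)
  ultimately have "component (d - total_degree \<alpha>) (Poly_Mapping.lookup p \<alpha>) =
      (\<Sum>i\<in>Poly_Mapping.keys f. if i = d then ?c d else 0)"
    by (simp add: p lookup_sum)
  also have "\<dots> = ?c d" by (simp add: in_keys_iff)
  finally show ?thesis using True by simp
next
  case False
  then show ?thesis
    using f[of d] by (auto simp: in_mpoly_grading_iff split: if_splits dest: spec[of _ \<alpha>])
qed

lemma mpoly_decomposition_exists:
  "\<exists>f :: nat \<Rightarrow>\<^sub>0 ('a, 'n::finite) mpoly.
     (\<forall>i. Poly_Mapping.lookup f i \<in> mpoly_grading grading i) \<and>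
     p = (\<Sum>i\<in>Poly_Mapping.keys f. Poly_Mapping.lookup f i)" (is "?D p")
proof -
  interpret M: vector_space "mpoly_scale scale :: 'k \<Rightarrow> ('a, 'n::finite) mpoly \<Rightarrow> _"
    by (rule vector_space_mpoly)
  note sub = subspace_mpoly_grading
  have D_add: "?D (p + q)" if p: "?D p" and q: "?D q" for p q
  proof -
    obtain f g where f: "\<And>i. Poly_Mapping.lookup f i \<in> mpoly_grading grading i"
      "p = (\<Sum>i\<in>Poly_Mapping.keys f. Poly_Mapping.lookup f i)"
      and g: "\<And>i. Poly_Mapping.lookup g i \<in> mpoly_grading grading i"
      "q = (\<Sum>i\<in>Poly_Mapping.keys g. Poly_Mapping.lookup g i)"
      using p q by blast
    let ?K = "Poly_Mapping.keys f \<union> Poly_Mapping.keys g"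
    have "(\<Sum>i\<in>Poly_Mapping.keys h. Poly_Mapping.lookup h i) = (\<Sum>i\<in>?K. Poly_Mapping.lookup h i)"
      if "Poly_Mapping.keys h \<subseteq> ?K" for h :: "nat \<Rightarrow>\<^sub>0 ('a, 'n) mpoly"
      using that by (intro sum.mono_neutral_left) (auto simp: in_keys_iff)
    from this[of f] this[of g] this[of "f + g"] have
      "p + q = (\<Sum>i\<in>Poly_Mapping.keys (f + g). Poly_Mapping.lookup (f + g) i)"
      using keys_add[of f g] f(2) g(2) by (simp add: lookup_add sum.distrib)
    then show ?thesis
      using f(1) g(1) by (intro exI[of _ "f + g"]) (auto simp: lookup_add M.subspace_add[OF sub])
  qed
  have D_homogeneous: "?D p" if "p \<in> mpoly_grading grading d" for p d
    using that by (intro exI[of _ "Poly_Mapping.single d p"])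
      (auto simp: lookup_single when_def M.subspace_0[OF sub])
  show ?thesis
  proof (induction p rule: mpoly_single_induct)
    case zero
    show ?case by (rule D_homogeneous[of 0 0]) (simp add: M.subspace_0[OF sub])
  next
    case (single \<alpha> a)
    show ?case
    proof (induction a rule: homogeneous_induct)
      case (homogeneous i a)
      then show ?case by (intro D_homogeneous[OF single_in_mpoly_grading])
    next
      case (add a b)
      then show ?case by (simp only: single_add D_add)
    qed
  next
    case (add p q)
    then show ?case by (rule D_add)
  qed
qed

theorem connected_graded_mpoly:
  "connected_graded_poisson_algebra (mpoly_scale scale :: 'k \<Rightarrow> ('a, 'n::finite) mpoly \<Rightarrow> _)
     (mpoly_bracket bracket) (mpoly_grading grading)"
proof (intro connected_graded_poisson_algebra.intro connected_graded_poisson_algebra_axioms.intro)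
  show "poisson_algebra (mpoly_scale scale :: 'k \<Rightarrow> ('a, 'n) mpoly \<Rightarrow> _) (mpoly_bracket bracket)"
    by (rule poisson_algebra_mpoly)
  show "module.subspace (mpoly_scale scale) (mpoly_grading grading i :: ('a, 'n) mpoly set)" for i
    by (rule subspace_mpoly_grading)
  show "\<exists>!f :: nat \<Rightarrow>\<^sub>0 ('a, 'n) mpoly. (\<forall>i. Poly_Mapping.lookup f i \<in> mpoly_grading grading i) \<and>
      p = (\<Sum>i\<in>Poly_Mapping.keys f. Poly_Mapping.lookup f i)" for p
  proof (rule ex_ex1I[OF mpoly_decomposition_exists])
    show "f = g"
      if f: "(\<forall>i. Poly_Mapping.lookup f i \<in> mpoly_grading grading i) \<and>
          p = (\<Sum>i\<in>Poly_Mapping.keys f. Poly_Mapping.lookup f i)"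
        and g: "(\<forall>i. Poly_Mapping.lookup g i \<in> mpoly_grading grading i) \<and>
          p = (\<Sum>i\<in>Poly_Mapping.keys g. Poly_Mapping.lookup g i)"
      for f g :: "nat \<Rightarrow>\<^sub>0 ('a, 'n) mpoly"
      by (intro poly_mapping_eqI)
        (use f g in \<open>simp add: lookup_sum_homogeneous[of f p] lookup_sum_homogeneous[of g p]\<close>)
  qed
  show "mpoly_grading grading 0 = range (\<lambda>c. mpoly_scale scale c (1 :: ('a, 'n) mpoly))"
  proof (intro set_eqI iffI)
    fix p :: "('a, 'n) mpoly" assume p: "p \<in> mpoly_grading grading 0"
    then have p0: "Poly_Mapping.lookup p 0 \<in> grading 0"
      unfolding constant_term_def[symmetric] by (rule constant_term_in_grading)
    have "Poly_Mapping.lookup p \<alpha> = 0" if "\<alpha> \<noteq> 0" for \<alpha>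
      using p that by (auto simp: in_mpoly_grading_iff split: if_splits dest: spec[of _ \<alpha>])
    then have "p = Poly_Mapping.single 0 (Poly_Mapping.lookup p 0)"
      by (intro poly_mapping_eqI) (auto simp: lookup_single when_def)
    moreover obtain c where "Poly_Mapping.lookup p 0 = scale c 1"
      using p0 grading_0 by auto
    ultimately have "p = mpoly_scale scale c 1"
      by (metis mpoly_scale_single single_one)
    then show "p \<in> range (\<lambda>c. mpoly_scale scale c 1)" by blast
  next
    fix p :: "('a, 'n) mpoly" assume "p \<in> range (\<lambda>c. mpoly_scale scale c 1)"
    then obtain c where "p = Poly_Mapping.single 0 (scale c 1)"
      by (metis mpoly_scale_single single_one rangeE)
    then show "p \<in> mpoly_grading grading 0"
      using single_in_mpoly_grading[of "scale c 1" 0 0] grading_0 by simp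
  qed
  show "p * q \<in> mpoly_grading grading (i + j)"
    if "p \<in> mpoly_grading grading i" "q \<in> mpoly_grading grading j" for p q :: "('a, 'n) mpoly" and i j
    by (rule mpoly_grading_biadditive[OF graded_biadditive_mult _ _ _ that])
      (simp_all add: distrib_left distrib_right mult_single)
  show "mpoly_bracket bracket p q \<in> mpoly_grading grading (i + j)"
    if "p \<in> mpoly_grading grading i" "q \<in> mpoly_grading grading j" for p q :: "('a, 'n) mpoly" and i j
    by (rule mpoly_grading_biadditive[OF graded_biadditive_bracket _ _ _ that])
      (simp_all add: mpoly_bracket_add_left mpoly_bracket_add_right mpoly_bracket_single)
qed

lemma in_span_mpoly_vars:
  fixes p :: "('a, 'n::finite) mpoly"
  assumes p: "p \<in> mpoly_grading grading 1" and "constant_term p = 0"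
  shows "p \<in> module.span (mpoly_scale scale) (range mpoly_var)"
proof -
  interpret M: vector_space "mpoly_scale scale :: 'k \<Rightarrow> ('a, 'n) mpoly \<Rightarrow> _"
    by (rule vector_space_mpoly)
  have "Poly_Mapping.single \<alpha> (Poly_Mapping.lookup p \<alpha>) \<in> M.span (range mpoly_var)"
    if "\<alpha> \<in> Poly_Mapping.keys p" for \<alpha>
  proof -
    have "\<alpha> \<noteq> 0" using that assms(2) by (auto simp: constant_term_def in_keys_iff)
    then have "total_degree \<alpha> \<noteq> 0" by simp
    moreover have *: "total_degree \<alpha> \<le> 1" "Poly_Mapping.lookup p \<alpha> \<in> grading (1 - total_degree \<alpha>)"
      using p that by (auto simp: mpoly_grading_def)
    ultimately have "total_degree \<alpha> = 1" by linarith
    then obtain i where i: "\<alpha> = Poly_Mapping.single i 1" by (rule total_degree_eq_1)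
    obtain c where "Poly_Mapping.lookup p \<alpha> = scale c 1"
      using *(2) \<open>total_degree \<alpha> = 1\<close> grading_0 by auto
    then have "Poly_Mapping.single \<alpha> (Poly_Mapping.lookup p \<alpha>) = mpoly_scale scale c (mpoly_var i)"
      by (simp add: i mpoly_var_def mpoly_scale_single)
    then show ?thesis by (simp add: M.span_scale M.span_base)
  qed
  then show ?thesis by (subst mpoly_as_sum) (rule M.span_sum)
qed

lemma constant_term_span_vars:
  fixes p :: "('a, 'n) mpoly"
  assumes "p \<in> module.span (mpoly_scale scale) (range mpoly_var)"
  shows "constant_term p = 0"
proof -
  interpret M: vector_space "mpoly_scale scale :: 'k \<Rightarrow> ('a, 'n) mpoly \<Rightarrow> _"
    by (rule vector_space_mpoly)
  have "M.span (range mpoly_var) \<subseteq> {p. constant_term p = 0}"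
    by (rule M.span_minimal)
      (auto simp: M.subspace_def constant_term_scale)
  then show ?thesis using assms by blast
qed

lemma mpoly_var_in_grading: "mpoly_var i \<in> mpoly_grading grading 1"
  using single_in_mpoly_grading[OF one_in_grading_0, of "Poly_Mapping.single i 1"]
  by (simp add: mpoly_var_def)

text \<open>
  Degree one consists of the degree-one part of the coefficients together with the scalar
  combinations of the variables; the former generate all constants, and these together with the
  variables generate every term.
\<close>

lemma finitely_generated_mpoly:
  assumes "finitely_generated_in_degree_one scale grading"
  shows "finitely_generated_in_degree_one (mpoly_scale scale :: 'k \<Rightarrow> ('a, 'n::finite) mpoly \<Rightarrow> _)
    (mpoly_grading grading)"
proof -
  interpret M: vector_space "mpoly_scale scale :: 'k \<Rightarrow> ('a, 'n) mpoly \<Rightarrow> _"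
    by (rule vector_space_mpoly)
  obtain S where S: "finite S" "span S = grading 1"
    and gen: "generated_algebra scale (grading 1) = UNIV"
    using assms by (auto simp: finitely_generated_in_degree_one_def)
  define S' where "S' = Poly_Mapping.single 0 ` S \<union> (range mpoly_var :: ('a, 'n) mpoly set)"
  have "M.span S' = mpoly_grading grading 1"
  proof
    have "Poly_Mapping.single 0 s \<in> mpoly_grading grading 1" if "s \<in> S" for s
      using that S(2) span_superset single_in_mpoly_grading[of s 1 0] by auto
    then show "M.span S' \<subseteq> mpoly_grading grading 1"
      by (intro M.span_minimal subspace_mpoly_grading) (auto simp: S'_def mpoly_var_in_grading[simplified])
    show "mpoly_grading grading 1 \<subseteq> M.span S'"
    proof
      fix p :: "('a, 'n) mpoly" assume p: "p \<in> mpoly_grading grading 1"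
      let ?c = "Poly_Mapping.single 0 (constant_term p)"
      have c: "constant_term p \<in> grading 1"
        using p by (rule constant_term_in_grading)
      have "?c \<in> M.span S'" if "constant_term p \<in> span S"
        using that
      proof (induction rule: span_induct_alt)
        case base
        show ?case by (simp add: M.span_zero)
      next
        case (step c x y)
        have "Poly_Mapping.single 0 x \<in> M.span S'" using step by (intro M.span_base) (simp add: S'_def)
        then show ?case using step
          by (simp add: single_add mpoly_scale_single[symmetric] M.span_add M.span_scale)
      qed
      then have "?c \<in> M.span S'" using c S(2) by simp
      moreover have "p - ?c \<in> M.span (range mpoly_var)"
        using p c single_in_mpoly_grading[OF c, of 0]
        by (intro in_span_mpoly_vars M.subspace_diff[OF subspace_mpoly_grading]) simp_all
      then have "p - ?c \<in> M.span S'"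
        using M.span_mono[of "range mpoly_var" S'] by (auto simp: S'_def)
      ultimately show "p \<in> M.span S'" using M.span_add[of "p - ?c" S' ?c] by simp
    qed
  qed
  moreover have "finite S'" using S by (simp add: S'_def)
  moreover have "T = UNIV"
    if T: "is_subalgebra (mpoly_scale scale) T" and G: "mpoly_grading grading 1 \<subseteq> T"
    for T :: "('a, 'n) mpoly set"
  proof -
    have sub: "M.subspace T" and one: "1 \<in> T"
      using T by (auto simp: is_subalgebra_def)
    have mult: "x * y \<in> T" if "x \<in> T" "y \<in> T" for x y
      using T that by (auto simp: is_subalgebra_def)
    have "is_subalgebra scale {a. Poly_Mapping.single 0 a \<in> T}"
      using M.subspace_0[OF sub] M.subspace_add[OF sub] M.subspace_scale[OF sub] one mult
        mult[of "Poly_Mapping.single 0 _" "Poly_Mapping.single 0 _"]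
      by (auto simp: is_subalgebra_def subspace_def single_add mpoly_scale_single[symmetric]
          mult_single)
    moreover have "grading 1 \<subseteq> {a. Poly_Mapping.single 0 a \<in> T}"
      using G single_in_mpoly_grading[of _ 1 0] by auto
    ultimately have "generated_algebra scale (grading 1) \<subseteq> {a. Poly_Mapping.single 0 a \<in> T}"
      by (intro hull_minimal)
    then have const: "Poly_Mapping.single 0 a \<in> T" for a using gen by auto
    have "Poly_Mapping.single \<alpha> 1 \<in> T" for \<alpha>
    proof (induction "total_degree \<alpha>" arbitrary: \<alpha>)
      case 0
      then show ?case using one by simp
    next
      case (Suc k)
      then have "\<alpha> \<noteq> 0" by auto
      then obtain i \<beta> where \<alpha>: "\<alpha> = Poly_Mapping.single i 1 + \<beta>" by (rule exponent_split)
      then have "Poly_Mapping.single \<beta> 1 \<in> T" using Suc by (simp add: total_degree_add)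
      moreover have "mpoly_var i \<in> T" using mpoly_var_in_grading G by blast
      ultimately have "mpoly_var i * Poly_Mapping.single \<beta> 1 \<in> T" by (intro mult)
      then show ?case by (simp add: \<alpha> mpoly_var_def mult_single)
    qed
    then have single: "Poly_Mapping.single \<alpha> a \<in> T" for \<alpha> a
      using mult[OF const[of a], of "Poly_Mapping.single \<alpha> 1"] by (simp add: mult_single)
    have "p \<in> T" for p
      by (induction p rule: mpoly_single_induct)
        (auto intro: single M.subspace_0[OF sub] M.subspace_add[OF sub])
    then show ?thesis by blast
  qed
  then have "generated_algebra (mpoly_scale scale) (mpoly_grading grading 1) =
      (UNIV :: ('a, 'n) mpoly set)"
    unfolding hull_def by blast
  ultimately show ?thesis unfolding finitely_generated_in_degree_one_def by blast
qed

end

section \<open>Cancelling the variables\<close>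

lemma lookup_mpoly_var:
  "Poly_Mapping.lookup (mpoly_var i) (Poly_Mapping.single j 1) = (if i = j then 1 else 0)"
proof -
  have "Poly_Mapping.single i (1::nat) = Poly_Mapping.single j 1 \<longleftrightarrow> i = j"
    by (metis lookup_single_eq lookup_single_not_eq zero_neq_one)
  then show ?thesis unfolding mpoly_var_def lookup_single by (simp only: when_def)
qed

lemma inj_mpoly_var: "inj (mpoly_var :: 'n \<Rightarrow> ('a::comm_ring_1, 'n) mpoly)"
  by (rule injI) (metis lookup_mpoly_var zero_neq_one)

context connected_graded_poisson_algebra
begin

text \<open>
  The elements without component of degree one form a subalgebra, since such a component of a
  product comes from a scalar in one factor and a degree-one component in the other. This subalgebra
  contains all generators of the center.
\<close>

lemma center_degree_one_eq_zero:
  assumes "generated_in_degree_at_least 2 scale grading (poisson_center bracket)"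
    and z: "z \<in> poisson_center bracket" "z \<in> grading 1"
  shows "z = 0"
proof -
  obtain S where S: "S \<subseteq> (\<Union>i\<in>{2..}. grading i)" "poisson_center bracket = generated_algebra scale S"
    using assms(1) by (auto simp: generated_in_degree_at_least_def)
  let ?T = "{x. component 1 x = 0}"
  have "is_subalgebra scale ?T"
    by (auto simp: is_subalgebra_def subspace_def component_add component_scale
        component_homogeneous[OF one_in_grading_0] component_biadditive[OF graded_biadditive_mult])
  moreover have "S \<subseteq> ?T"
    using S(1) by (force simp: component_homogeneous)
  ultimately have "poisson_center bracket \<subseteq> ?T"
    unfolding S(2) by (intro hull_minimal)
  then have "component 1 z = 0" using z(1) by blast
  then show ?thesis using z(2) by (simp add: component_homogeneous)
qed

text \<open>
  Taking constant terms respects brackets, so the constant term of a central polynomial of degree one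
  is a central element of degree one.
\<close>

lemma mpoly_center_degree_one:
  fixes p :: "('a, 'n::finite) mpoly"
  assumes center: "\<And>z. z \<in> poisson_center bracket \<Longrightarrow> z \<in> grading 1 \<Longrightarrow> z = 0"
    and p: "p \<in> poisson_center (mpoly_bracket bracket)" "p \<in> mpoly_grading grading 1"
  shows "p \<in> module.span (mpoly_scale scale) (range mpoly_var)"
proof -
  have "bracket (constant_term p) b = 0" for b
    using p(1) constant_term_bracket[of p "Poly_Mapping.single 0 b"]
    by (simp add: poisson_center_def)
  then have "constant_term p = 0"
    using constant_term_in_grading[OF p(2)] by (intro center) (simp_all add: poisson_center_def)
  then show ?thesis by (rule in_span_mpoly_vars[OF p(2)])
qed

lemma independent_mpoly_vars:
  "\<not> module.dependent (mpoly_scale scale) (range (mpoly_var :: 'n::finite \<Rightarrow> ('a, 'n) mpoly))"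
proof -
  interpret M: vector_space "mpoly_scale scale :: 'k \<Rightarrow> ('a, 'n) mpoly \<Rightarrow> _"
    by (rule vector_space_mpoly)
  show "M.independent (range mpoly_var)"
  proof (rule M.independent_if_scalars_zero)
    fix f and x :: "('a, 'n) mpoly"
    assume sum: "(\<Sum>x\<in>range (mpoly_var :: 'n \<Rightarrow> ('a, 'n) mpoly). mpoly_scale scale (f x) x) = 0"
      and "x \<in> range (mpoly_var :: 'n \<Rightarrow> ('a, 'n) mpoly)"
    then obtain j where j: "x = mpoly_var j" by blast
    have "0 = Poly_Mapping.lookup
        (\<Sum>i\<in>UNIV. mpoly_scale scale (f (mpoly_var i)) (mpoly_var i :: ('a, 'n) mpoly))
        (Poly_Mapping.single j 1)"
      using sum by (simp add: sum.reindex[OF inj_mpoly_var])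
    also have "\<dots> = (\<Sum>i\<in>UNIV. if i = j then scale (f x) 1 else 0)"
      unfolding lookup_sum lookup_mpoly_scale lookup_mpoly_var by (intro sum.cong) (auto simp: j)
    finally show "f x = 0" by (simp add: scale_eq_0_iff)
  qed simp
qed

end

context graded_poisson_pair
begin

text \<open>
  The inverse of the given isomorphism \<open>\<theta>\<close> maps the span of the variables, which are central of degree
  one, into the span of the variables; by dimension it does so bijectively. Hence \<open>\<theta>\<close> and its inverse
  preserve the ideals of polynomials without constant term, and passing to constant terms is
  an isomorphism of the quotients.
\<close>

lemma cancel_polynomial_variables:
  assumes center: "\<And>z. z \<in> poisson_center bracketA \<Longrightarrow> z \<in> gradingA 1 \<Longrightarrow> z = 0"
    and iso: "graded_poisson_isomorphic
      (mpoly_scale scaleA :: 'k \<Rightarrow> ('a, 'n::finite) mpoly \<Rightarrow> _) (mpoly_bracket bracketA) (mpoly_grading gradingA)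
      (mpoly_scale scaleB :: 'k \<Rightarrow> ('b, 'n) mpoly \<Rightarrow> _) (mpoly_bracket bracketB) (mpoly_grading gradingB)"
  shows "graded_poisson_isomorphic scaleA bracketA gradingA scaleB bracketB gradingB"
proof -
  interpret MA: poisson_algebra "mpoly_scale scaleA :: 'k \<Rightarrow> ('a, 'n) mpoly \<Rightarrow> _" "mpoly_bracket bracketA"
    by (rule A.poisson_algebra_mpoly)
  interpret MB: poisson_algebra "mpoly_scale scaleB :: 'k \<Rightarrow> ('b, 'n) mpoly \<Rightarrow> _" "mpoly_bracket bracketB"
    by (rule B.poisson_algebra_mpoly)
  obtain \<theta> :: "('a, 'n) mpoly \<Rightarrow> ('b, 'n) mpoly" where
    \<theta>: "poisson_iso (mpoly_scale scaleA) (mpoly_bracket bracketA) (mpoly_scale scaleB) (mpoly_bracket bracketB) \<theta>"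
    and graded: "\<And>i. \<theta> ` mpoly_grading gradingA i = mpoly_grading gradingB i"
    using iso by (auto simp: graded_poisson_isomorphic_def)
  define \<psi> where "\<psi> = inv \<theta>"
  have \<psi>: "poisson_iso (mpoly_scale scaleB) (mpoly_bracket bracketB) (mpoly_scale scaleA) (mpoly_bracket bracketA) \<psi>"
    unfolding \<psi>_def by (rule poisson_iso_inv[OF \<theta>])
  interpret \<theta>: Vector_Spaces.linear "mpoly_scale scaleA" "mpoly_scale scaleB" \<theta>
    using \<theta> by (simp add: poisson_iso_def)
  interpret \<psi>: Vector_Spaces.linear "mpoly_scale scaleB" "mpoly_scale scaleA" \<psi>
    using \<psi> by (simp add: poisson_iso_def)
  have bij: "bij \<theta>" "bij \<psi>" using \<theta> \<psi> by (simp_all add: poisson_iso_def)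
  have \<theta>\<psi> [simp]: "\<theta> (\<psi> q) = q" and \<psi>\<theta> [simp]: "\<psi> (\<theta> p) = p" for p q
    using bij(1) by (simp_all add: \<psi>_def surj_f_inv_f bij_is_surj inv_f_f bij_is_inj)
  have mult: "\<theta> (p * p') = \<theta> p * \<theta> p'" "\<psi> (q * q') = \<psi> q * \<psi> q'" for p p' q q'
    using \<theta> \<psi> by (simp_all add: poisson_iso_def)
  have bracket: "\<theta> (mpoly_bracket bracketA p p') = mpoly_bracket bracketB (\<theta> p) (\<theta> p')"
    "\<psi> (mpoly_bracket bracketB q q') = mpoly_bracket bracketA (\<psi> q) (\<psi> q')" for p p' q q'
    using \<theta> \<psi> by (simp_all add: poisson_iso_def)
  have one: "\<theta> 1 = 1" using \<theta> by (simp add: poisson_iso_def)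
  have graded': "\<psi> q \<in> mpoly_grading gradingA i" if "q \<in> mpoly_grading gradingB i" for q i
    using graded[of i] that by (metis \<psi>\<theta> imageE)
  have \<psi>_vars: "\<psi> (mpoly_var i) \<in> MA.span (range mpoly_var)" for i
  proof (rule A.mpoly_center_degree_one[OF center])
    have "mpoly_bracket bracketA (\<psi> (mpoly_var i)) p = \<psi> (mpoly_bracket bracketB (mpoly_var i) (\<theta> p))" for p
      by (simp add: bracket)
    also have "\<psi> (mpoly_bracket bracketB (mpoly_var i) (\<theta> p)) = 0" for p
      using B.mpoly_variable_central[of i] by (simp add: poisson_center_def mpoly_var_def \<psi>.zero)
    finally show "\<psi> (mpoly_var i) \<in> poisson_center (mpoly_bracket bracketA)"
      by (simp add: poisson_center_def)
  qed (simp_all add: graded' B.mpoly_var_in_grading[simplified])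
  let ?T = "\<psi> ` range mpoly_var"
  have indep: "MA.independent ?T"
    by (intro \<psi>.independent_injective_image B.independent_mpoly_vars
        inj_on_subset[OF bij_is_inj[OF bij(2)]] subset_UNIV)
  have card: "card ?T = card (range (mpoly_var :: 'n \<Rightarrow> ('a, 'n) mpoly))"
    by (simp add: card_image inj_mpoly_var inj_on_subset[OF bij_is_inj[OF bij(2)] subset_UNIV])
  have sub: "?T \<subseteq> MA.span (range mpoly_var)"
    using \<psi>_vars by blast
  have "range mpoly_var \<subseteq> MA.span ?T"
    by (rule MA.span_eq_if_card_eq[OF _ indep sub card]) simp
  also have "MA.span ?T = \<psi> ` MB.span (range mpoly_var)" by (rule \<psi>.span_image)
  finally have "mpoly_var i \<in> \<psi> ` MB.span (range mpoly_var)" for i by blast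
  then have \<theta>_vars: "\<theta> (mpoly_var i) \<in> MB.span (range mpoly_var)" for i
    by (metis \<theta>\<psi> imageE)
  have \<theta>_const: "constant_term (\<theta> p) = 0" if "constant_term p = 0" for p
    by (rule constant_term_eq_0_if_vars[of \<theta>, OF \<theta>.add mult(1) B.constant_term_span_vars[OF \<theta>_vars] that])
  have \<psi>_const: "constant_term (\<psi> q) = 0" if "constant_term q = 0" for q
    by (rule constant_term_eq_0_if_vars[of \<psi>, OF \<psi>.add mult(2) A.constant_term_span_vars[OF \<psi>_vars] that])
  \<comment> \<open>The map induced by \<open>\<theta>\<close> on the quotients by the ideals of the variables.\<close>
  define f where "f a = constant_term (\<theta> (Poly_Mapping.single 0 a))" for a
  have f_\<psi>: "f (constant_term (\<psi> (Poly_Mapping.single 0 b))) = b" for b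
  proof -
    let ?q = "\<psi> (Poly_Mapping.single 0 b)"
    have "constant_term (\<theta> (?q - Poly_Mapping.single 0 (constant_term ?q))) = 0"
      by (rule \<theta>_const) simp
    then show ?thesis by (simp add: f_def \<theta>.diff)
  qed
  have f_add: "f (x + y) = f x + f y" for x y by (simp add: f_def single_add \<theta>.add)
  have f_scale: "f (scaleA c x) = scaleB c (f x)" for c x
    by (simp add: f_def A.mpoly_scale_single[symmetric] \<theta>.scale B.constant_term_scale)
  have lin: "Vector_Spaces.linear scaleA scaleB f"
    by (intro Vector_Spaces.linear.intro module_hom.intro module_hom_axioms.intro f_add f_scale)
      (fact A.vector_space_axioms B.vector_space_axioms A.module_axioms B.module_axioms)+
  interpret f: Vector_Spaces.linear scaleA scaleB f by (rule lin)
  have "a = 0" if "f a = 0" for a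
    using \<psi>_const[of "\<theta> (Poly_Mapping.single 0 a)"] that by (simp add: f_def)
  then have "inj f" by (intro injI) (metis f.diff right_minus_eq)
  moreover have "surj f" by (rule surjI[of f]) (rule f_\<psi>)
  ultimately have "bij f" by (simp add: bij_def)
  moreover have "f 1 = 1" by (simp add: f_def one constant_term_one)
  moreover have "f (x * y) = f x * f y" for x y
    using mult(1)[of "Poly_Mapping.single 0 x" "Poly_Mapping.single 0 y"]
    by (simp add: f_def mult_single constant_term_mult)
  moreover have "f (bracketA x y) = bracketB (f x) (f y)" for x y
    using bracket(1)[of "Poly_Mapping.single 0 x" "Poly_Mapping.single 0 y"]
    by (simp add: f_def A.mpoly_bracket_const B.constant_term_bracket)
  ultimately have "poisson_iso scaleA bracketA scaleB bracketB f"
    using lin by (simp add: poisson_iso_def)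
  moreover have "f ` gradingA i = gradingB i" for i
  proof
    show "f ` gradingA i \<subseteq> gradingB i"
    proof (intro image_subsetI)
      fix a assume "a \<in> gradingA i"
      then have "\<theta> (Poly_Mapping.single 0 a) \<in> mpoly_grading gradingB i"
        using A.single_in_mpoly_grading[of a i 0] graded[of i] by auto
      then show "f a \<in> gradingB i"
        by (simp add: f_def B.constant_term_in_grading)
    qed
    show "gradingB i \<subseteq> f ` gradingA i"
    proof
      fix b assume "b \<in> gradingB i"
      then have "constant_term (\<psi> (Poly_Mapping.single 0 b)) \<in> gradingA i"
        using B.single_in_mpoly_grading[of b i 0] by (intro A.constant_term_in_grading graded') simp
      then show "b \<in> f ` gradingA i" using f_\<psi>[of b] by force
    qed
  qed
  ultimately show ?thesis unfolding graded_poisson_isomorphic_def by blast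
qed

end

theorem theorem4p5:
  fixes scaleA :: "'k::field \<Rightarrow> 'a::comm_ring_1 \<Rightarrow> 'a"
    and scaleB :: "'k \<Rightarrow> 'b::comm_ring_1 \<Rightarrow> 'b"
    and bracketA :: "'a \<Rightarrow> 'a \<Rightarrow> 'a"
    and bracketB :: "'b \<Rightarrow> 'b \<Rightarrow> 'b"
    and gradingA :: "nat \<Rightarrow> 'a set"
    and gradingB :: "nat \<Rightarrow> 'b set"
  assumes "connected_graded_poisson_algebra scaleA bracketA gradingA"
    and "connected_graded_poisson_algebra scaleB bracketB gradingB"
    and "finitely_generated_in_degree_one scaleA gradingA"
    and "finitely_generated_in_degree_one scaleB gradingB"
    and "generated_in_degree_at_least 2 scaleA gradingA (poisson_center bracketA) \<or>
         generated_in_degree_at_least 2 scaleB gradingB (poisson_center bracketB)"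
    and "poisson_isomorphic
           (mpoly_scale scaleA :: 'k \<Rightarrow> ('a, 'n::finite) mpoly \<Rightarrow> ('a, 'n) mpoly)
           (mpoly_bracket bracketA)
           (mpoly_scale scaleB :: 'k \<Rightarrow> ('b, 'n) mpoly \<Rightarrow> ('b, 'n) mpoly)
           (mpoly_bracket bracketB)"
  shows "graded_poisson_isomorphic scaleA bracketA gradingA scaleB bracketB gradingB"
proof -
  interpret AB: graded_poisson_pair scaleA bracketA gradingA scaleB bracketB gradingB
    using assms(1,2) by (rule graded_poisson_pair.intro)
  interpret BA: graded_poisson_pair scaleB bracketB gradingB scaleA bracketA gradingA
    using assms(2,1) by (rule graded_poisson_pair.intro)
  obtain \<phi> where "poisson_iso
      (mpoly_scale scaleA :: 'k \<Rightarrow> ('a, 'n) mpoly \<Rightarrow> _) (mpoly_bracket bracketA)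
      (mpoly_scale scaleB :: 'k \<Rightarrow> ('b, 'n) mpoly \<Rightarrow> _) (mpoly_bracket bracketB) \<phi>"
    using assms(6) by (auto simp: poisson_isomorphic_def)
  then have "ungraded_isomorphism
      (mpoly_scale scaleA :: 'k \<Rightarrow> ('a, 'n) mpoly \<Rightarrow> _) (mpoly_bracket bracketA) (mpoly_grading gradingA)
      (mpoly_scale scaleB :: 'k \<Rightarrow> ('b, 'n) mpoly \<Rightarrow> _) (mpoly_bracket bracketB) (mpoly_grading gradingB) \<phi>"
    by (intro ungraded_isomorphism.intro graded_poisson_pair.intro ungraded_isomorphism_axioms.intro
        AB.A.connected_graded_mpoly AB.B.connected_graded_mpoly
        AB.A.finitely_generated_mpoly AB.B.finitely_generated_mpoly assms(3,4))
  note iso = ungraded_isomorphism.graded_isomorphism[OF this]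
  from assms(5) show ?thesis
  proof
    assume "generated_in_degree_at_least 2 scaleA gradingA (poisson_center bracketA)"
    then show ?thesis
      by (intro AB.cancel_polynomial_variables[OF _ iso] AB.A.center_degree_one_eq_zero)
  next
    assume center: "generated_in_degree_at_least 2 scaleB gradingB (poisson_center bracketB)"
    show ?thesis
      by (rule graded_poisson_isomorphic_sym)
        (rule BA.cancel_polynomial_variables[OF AB.B.center_degree_one_eq_zero[OF center]
          graded_poisson_isomorphic_sym[OF iso]])
  qed
qed

end
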